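(* Fix $\alpha\ge0$. Let $z=(z_v(\boldsymbol e,\boldsymbol a))$ be a feasible solution to (LP-C) for an instance $G=(U,V,E)$ of the action-reward query-commit matching problem, and suppose that for each $u\in U$ the P-RCRS $\psi_u$ used by the rounding policy described below is $\alpha$-selectable on inputs with patience $\ell_u$. Then the expected reward of the rounding policy is at least $\alpha\sum_{v\in V}\sum_{(\boldsymbol e,\boldsymbol a)\in\mathcal{C}_v}\mathrm{val}(\boldsymbol e,\boldsymbol a)\,z_v(\boldsymbol e,\boldsymbol a)$.
   Context: Problem: bipartite $G=(U,V,E)$, finite action set $\mathcal{A}$, $q_e(a)\in[0,1]$, $r_e(a)\ge0$, patience $\ell_s\in\{1,2,\dots\}\cup\{\infty\}$. A policy adaptively queries edges $e$ via actions $a$; an independent $Q_e(a)\sim\mathrm{Ber}(q_e(a))$ is revealed; if $1$, $e$ must join the matching and $r_e(a)$ is earned, else $e$ is discarded; each edge is queried via at most one action; vertex $s$ has at most $\ell_s$ incident queries; the output is a matching. Notation: $\partial(s)$, $\mathcal{C}_v$ (sequences of $\le\ell_v$ distinct edges of $\partial(v)$ with action sequences), $\mathrm{val}(\boldsymbol e,\boldsymbol a)=\sum_i r_{e_i}(a_i)q_{e_i}(a_i)\prod_{j<i}(1-q_{e_j}(a_j))$; (LP-C): maximize $\sum_v\sum_{\mathcal{C}_v}\mathrm{val}\cdot z_v$ over $z\ge0$ with, for each $u\in U$, $\sum_v\sum_{i:e_i=(u,v)}q_{(u,v)}(a_i)\prod_{j<i}(1-q_{e_j}(a_j))z_v(\boldsymbol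 e,\boldsymbol a)\le1$ and $\sum_v\sum_{i:e_i=(u,v)}\prod_{j<i}(1-q_{e_j}(a_j))z_v(\boldsymbol e,\boldsymbol a)\le\ell_u$, and for each $v$, $\sum_{\mathcal{C}_v}z_v\le1$. Set $\tilde z_{u,v}(a)=\sum_{i,(\boldsymbol e,\boldsymbol a)\in\mathcal{C}_v:e_i=(u,v),a_i=a}\prod_{j<i}(1-q_{e_j}(a_j))z_v(\boldsymbol e,\boldsymbol a)$. P-RCRS: an input $(\mathcal{A},n,\ell,(p_i(a)),(x_i(a)))$ consists of $\ell\in\{1,2,\dots\}\cup\{\infty\}$ and probabilities with $\sum_{i,a}x_i(a)\le\ell$, $\sum_{i,a}p_i(a)x_i(a)\le1$, $\sum_a x_i(a)\le1$ for each $i\in[n]$. Independently across $i$, states $P_i(a)\sim\mathrm{Ber}(p_i(a))$ (independent over $a$) and suggestions $(X_i(a))_a$ with $X_i(a)\sim\mathrm{Ber}(x_i(a))$, $\sum_aX_i(a)\le1$, are drawn. Elements arrive in uniformly random order; when $i$ arrives, $(X_i(a))_a$ is revealed; if $X_i(a)=1$ for some $a$, the (possibly randomized) scheme may query $i$ via $a$, revealing $P_i(a)$, and if $P_i(a)=1$ it must output $(i,a)$ and stop; otherwise it passes. At most $\ell$ queries are allowed. It is $\alpha$-selectable on the input if $\Pr[i\text{ queried via }a\mid X_i(a)=1]\ge\alpha$ for all $i,a$, and $\alpha$-selectable on inputs with patience $\ell$ if this holds for all inputs with patience $\ell$. Rounding policy (given $z$ and P-RCRSs $(\psi_u)_{u\in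 U}$): draw independent $\tilde Q_e(a)\sim\mathrm{Ber}(q_e(a))$ for all $e,a$, and a uniformly random order $\pi$ of $V$. Process $v\in V$ in order $\pi$: draw $(\boldsymbol e,\boldsymbol a)\in\mathcal{C}_v$ independently with probability $z_v(\boldsymbol e,\boldsymbol a)$ (nothing with the remaining probability). For $j=1,\dots,k$ with $e_j=(u_j,v)$: set suggestion $\tilde Z_{u_j,v}(a_j)=1$ (all suggestions are $0$ by default) and let $\psi_{u_j}$, run on the P-RCRS input with elements $\partial(u_j)$, action set $\mathcal{A}$, patience $\ell_{u_j}$, probabilities $(q_{u_j,v'}(a'))$ and $(\tilde z_{u_j,v'}(a'))$, with arrival order induced by $\pi$, states $(Q_{u_j,v'}(a'))$ and suggestions $(\tilde Z_{u_j,v'}(a'))$, process $(u_j,v)$. If $\psi_{u_j}$ queries $(u_j,v)$ via $a_j$, the policy queries $(u_j,v)$ via $a_j$, and if $Q_{u_j,v}(a_j)=1$ adds $(u_j,v)$ to the matching and stops processing $v$; otherwise (no query), if $\tilde Q_{u_j,v}(a_j)=1$ it stops processing $v$. *)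

theory Defs
  imports "HOL-Probability.Probability"
begin

section \<open>Random-order contention resolution with probing (P-RCRS)\<close>

text \<open>
  The ground set is an arbitrary finite set rather than an initial segment of the naturals, so that
  the edges at a vertex can serve directly as elements. Values of the two probability functions
  outside the carriers are irrelevant.
\<close>

record ('i, 'a) prcrs_input =
  in_actions :: "'a set"
  in_elems :: "'i set"
  in_patience :: enat
  in_state_prob :: "'i \<Rightarrow> 'a \<Rightarrow> real"
  in_sugg_prob :: "'i \<Rightarrow> 'a \<Rightarrow> real"

definition valid_input :: "('i, 'a) prcrs_input \<Rightarrow> bool" where
  "valid_input I \<longleftrightarrow>
     finite (in_actions I) \<and> finite (in_elems I) \<and> 1 \<le> in_patience I \<and>
     (\<forall>i\<in>in_elems I. \<forall>a\<in>in_actions I.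
        in_state_prob I i a \<in> {0..1} \<and> in_sugg_prob I i a \<in> {0..1}) \<and>
     ereal (\<Sum>i\<in>in_elems I. \<Sum>a\<in>in_actions I. in_sugg_prob I i a)
       \<le> ereal_of_enat (in_patience I) \<and>
     (\<Sum>i\<in>in_elems I. \<Sum>a\<in>in_actions I. in_state_prob I i a * in_sugg_prob I i a) \<le> 1 \<and>
     (\<forall>i\<in>in_elems I. (\<Sum>a\<in>in_actions I. in_sugg_prob I i a) \<le> 1)"

text \<open>
  A suggestion vector with at most one entry equal to 1 is encoded as an option value:
  \<open>Some a\<close> means that \<open>a\<close> is suggested, \<open>None\<close> that all entries are 0.
  A history lists, in order of arrival, what a scheme has observed and done: \<open>Pass i s\<close> for an
  element passed over after its suggestion \<open>s\<close> was revealed, and \<open>Query i a b\<close> for an element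
  queried via its suggested action \<open>a\<close> whose revealed state is \<open>b\<close>.
\<close>

datatype ('i, 'a) event =
    Pass (ev_elem: 'i) "'a option"
  | is_Query: Query (ev_elem: 'i) 'a bool

text \<open>
  A randomized online scheme: given the input, its history so far and an arriving element with
  suggested action, it flips a (fresh) coin that decides whether it wants to query. As the history
  contains all observations and all past decisions of the scheme, this covers every form of
  internal randomization.
\<close>

type_synonym ('i, 'a) prcrs =
  "('i, 'a) prcrs_input \<Rightarrow> ('i, 'a) event list \<Rightarrow> 'i \<Rightarrow> 'a \<Rightarrow> bool pmf"

definition has_output :: "('i, 'a) event list \<Rightarrow> bool" where
  "has_output h \<longleftrightarrow> (\<exists>i a. Query i a True \<in> set h)"

definition num_queries :: "('i, 'a) event list \<Rightarrow> nat" where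
  "num_queries h = length (filter is_Query h)"

text \<open>
  The rules of the game (stop after an output, respect the patience) are enforced here, so that
  every function of the type above is a legal scheme.
\<close>

definition scheme_decision ::
  "('i, 'a) prcrs \<Rightarrow> ('i, 'a) prcrs_input \<Rightarrow> ('i, 'a) event list \<Rightarrow> 'i \<Rightarrow> 'a option \<Rightarrow> bool pmf"
where
  "scheme_decision \<psi> I h i s =
     (case s of
        None \<Rightarrow> return_pmf False
      | Some a \<Rightarrow>
          if has_output h \<or> in_patience I \<le> enat (num_queries h) then return_pmf False
          else \<psi> I h i a)"

primrec prcrs_run ::
  "('i, 'a) prcrs \<Rightarrow> ('i, 'a) prcrs_input \<Rightarrow> ('i \<times> 'a \<Rightarrow> bool) \<Rightarrow> ('i \<Rightarrow> 'a option) \<Rightarrow>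
   'i list \<Rightarrow> ('i, 'a) event list \<Rightarrow> ('i, 'a) event list pmf"
where
  "prcrs_run \<psi> I P X [] h = return_pmf h"
| "prcrs_run \<psi> I P X (i # is) h =
     do {
       b \<leftarrow> scheme_decision \<psi> I h i (X i);
       prcrs_run \<psi> I P X is
         (h @ [if b then Query i (the (X i)) (P (i, the (X i))) else Pass i (X i)])
     }"

text \<open>
  The subprobability mass function with the given weights on the given set; the missing mass goes
  to \<open>None\<close>.
\<close>

definition sub_draw :: "'b set \<Rightarrow> ('b \<Rightarrow> real) \<Rightarrow> 'b option pmf" where
  "sub_draw S w = embed_spmf (\<lambda>s. if s \<in> S then w s else 0)"

text \<open>The joint law of the suggestions and the final history.\<close>

definition prcrs_experiment ::
  "('i, 'a) prcrs \<Rightarrow> ('i, 'a) prcrs_input \<Rightarrow> (('i \<Rightarrow> 'a option) \<times> ('i, 'a) event list) pmf"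
where
  "prcrs_experiment \<psi> I =
     do {
       P \<leftarrow> Pi_pmf (in_elems I \<times> in_actions I) False (\<lambda>(i, a). bernoulli_pmf (in_state_prob I i a));
       X \<leftarrow> Pi_pmf (in_elems I) None (\<lambda>i. sub_draw (in_actions I) (in_sugg_prob I i));
       \<sigma> \<leftarrow> pmf_of_set (permutations_of_set (in_elems I));
       h \<leftarrow> prcrs_run \<psi> I P X \<sigma> [];
       return_pmf (X, h)
     }"

text \<open>The condition is required only where the conditioning event has positive probability.\<close>

definition selectable_on :: "('i, 'a) prcrs \<Rightarrow> ('i, 'a) prcrs_input \<Rightarrow> real \<Rightarrow> bool" where
  "selectable_on \<psi> I \<alpha> \<longleftrightarrow>
     (\<forall>i\<in>in_elems I. \<forall>a\<in>in_actions I. in_sugg_prob I i a > 0 \<longrightarrow>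
        \<P>(\<omega> in measure_pmf (prcrs_experiment \<psi> I).
            (\<exists>b. Query i a b \<in> set (snd \<omega>)) \<bar> fst \<omega> i = Some a) \<ge> \<alpha>)"

definition selectable :: "('i, 'a) prcrs \<Rightarrow> enat \<Rightarrow> real \<Rightarrow> bool" where
  "selectable \<psi> l \<alpha> \<longleftrightarrow> (\<forall>I. valid_input I \<and> in_patience I = l \<longrightarrow> selectable_on \<psi> I \<alpha>)"


section \<open>The action-reward query-commit matching problem\<close>

record ('u, 'v, 'a) qc_instance =
  left :: "'u set"
  right :: "'v set"
  edges :: "('u \<times> 'v) set"
  acts :: "'a set"
  qprob :: "'u \<times> 'v \<Rightarrow> 'a \<Rightarrow> real"
  reward :: "'u \<times> 'v \<Rightarrow> 'a \<Rightarrow> real"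
  lpat :: "'u \<Rightarrow> enat"
  rpat :: "'v \<Rightarrow> enat"

definition valid_instance :: "('u, 'v, 'a) qc_instance \<Rightarrow> bool" where
  "valid_instance G \<longleftrightarrow>
     finite (left G) \<and> finite (right G) \<and> edges G \<subseteq> left G \<times> right G \<and> finite (acts G) \<and>
     (\<forall>e\<in>edges G. \<forall>a\<in>acts G. qprob G e a \<in> {0..1} \<and> reward G e a \<ge> 0) \<and>
     (\<forall>u\<in>left G. 1 \<le> lpat G u) \<and> (\<forall>v\<in>right G. 1 \<le> rpat G v)"

definition edges_at_left :: "('u, 'v, 'a) qc_instance \<Rightarrow> 'u \<Rightarrow> ('u \<times> 'v) set" where
  "edges_at_left G u = {e \<in> edges G. fst e = u}"

definition edges_at_right :: "('u, 'v, 'a) qc_instance \<Rightarrow> 'v \<Rightarrow> ('u \<times> 'v) set" where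
  "edges_at_right G v = {e \<in> edges G. snd e = v}"

text \<open>
  An edge sequence together with its action sequence is encoded as one list of pairs; the empty
  sequence is allowed (its value is 0).
\<close>

definition query_seqs :: "('u, 'v, 'a) qc_instance \<Rightarrow> 'v \<Rightarrow> (('u \<times> 'v) \<times> 'a) list set" where
  "query_seqs G v =
     {s. set s \<subseteq> edges_at_right G v \<times> acts G \<and> distinct (map fst s) \<and>
         enat (length s) \<le> rpat G v}"

definition reach_prob :: "('u, 'v, 'a) qc_instance \<Rightarrow> (('u \<times> 'v) \<times> 'a) list \<Rightarrow> nat \<Rightarrow> real" where
  "reach_prob G s i = (\<Prod>j<i. 1 - qprob G (fst (s ! j)) (snd (s ! j)))"

definition val :: "('u, 'v, 'a) qc_instance \<Rightarrow> (('u \<times> 'v) \<times> 'a) list \<Rightarrow> real" where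
  "val G s =
     (\<Sum>i<length s. reward G (fst (s ! i)) (snd (s ! i)) * qprob G (fst (s ! i)) (snd (s ! i))
        * reach_prob G s i)"

type_synonym ('u, 'v, 'a) lp_var = "'v \<Rightarrow> (('u \<times> 'v) \<times> 'a) list \<Rightarrow> real"

definition LPC_feasible :: "('u, 'v, 'a) qc_instance \<Rightarrow> ('u, 'v, 'a) lp_var \<Rightarrow> bool" where
  "LPC_feasible G z \<longleftrightarrow>
     (\<forall>v\<in>right G. \<forall>s\<in>query_seqs G v. z v s \<ge> 0) \<and>
     (\<forall>u\<in>left G.
        (\<Sum>v\<in>right G. \<Sum>s\<in>query_seqs G v. \<Sum>i | i < length s \<and> fst (s ! i) = (u, v).
           qprob G (u, v) (snd (s ! i)) * reach_prob G s i * z v s) \<le> 1) \<and>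
     (\<forall>u\<in>left G.
        ereal (\<Sum>v\<in>right G. \<Sum>s\<in>query_seqs G v. \<Sum>i | i < length s \<and> fst (s ! i) = (u, v).
           reach_prob G s i * z v s) \<le> ereal_of_enat (lpat G u)) \<and>
     (\<forall>v\<in>right G. (\<Sum>s\<in>query_seqs G v. z v s) \<le> 1)"

definition z_tilde ::
  "('u, 'v, 'a) qc_instance \<Rightarrow> ('u, 'v, 'a) lp_var \<Rightarrow> 'u \<times> 'v \<Rightarrow> 'a \<Rightarrow> real"
where
  "z_tilde G z e a =
     (\<Sum>s\<in>query_seqs G (snd e). \<Sum>i | i < length s \<and> s ! i = (e, a).
        reach_prob G s i * z (snd e) s)"


section \<open>The rounding policy\<close>

definition induced_input ::
  "('u, 'v, 'a) qc_instance \<Rightarrow> ('u, 'v, 'a) lp_var \<Rightarrow> 'u \<Rightarrow> ('u \<times> 'v, 'a) prcrs_input"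
where
  "induced_input G z u =
     \<lparr> in_actions = acts G, in_elems = edges_at_left G u, in_patience = lpat G u,
       in_state_prob = qprob G, in_sugg_prob = z_tilde G z \<rparr>"

text \<open>
  The state of the policy: the histories of the simulated schemes, and the current matching, each
  edge being recorded with the action through which it was queried.
\<close>

type_synonym ('u, 'v, 'a) policy_state =
  "('u \<Rightarrow> ('u \<times> 'v, 'a) event list) \<times> (('u \<times> 'v) \<times> 'a) set"

definition record_event ::
  "'u \<Rightarrow> ('u \<times> 'v, 'a) event \<Rightarrow> ('u \<Rightarrow> ('u \<times> 'v, 'a) event list) \<Rightarrow>
   ('u \<Rightarrow> ('u \<times> 'v, 'a) event list)"
where
  "record_event u x H = H(u := H u @ [x])"

fun process_seq ::
  "('u, 'v, 'a) qc_instance \<Rightarrow> ('u, 'v, 'a) lp_var \<Rightarrow> ('u \<Rightarrow> ('u \<times> 'v, 'a) prcrs) \<Rightarrow>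
   (('u \<times> 'v) \<times> 'a \<Rightarrow> bool) \<Rightarrow> (('u \<times> 'v) \<times> 'a \<Rightarrow> bool) \<Rightarrow>
   (('u \<times> 'v) \<times> 'a) list \<Rightarrow> ('u, 'v, 'a) policy_state \<Rightarrow> ('u, 'v, 'a) policy_state pmf"
where
  "process_seq G z \<psi> Q Q' [] (H, M) = return_pmf (H, M)"
| "process_seq G z \<psi> Q Q' (((u, v), a) # s) (H, M) =
     do {
       b \<leftarrow> scheme_decision (\<psi> u) (induced_input G z u) (H u) (u, v) (Some a);
       if b then
         (let H' = record_event u (Query (u, v) a (Q ((u, v), a))) H
          in if Q ((u, v), a) then return_pmf (H', insert ((u, v), a) M)
             else process_seq G z \<psi> Q Q' s (H', M))
       else
         (let H' = record_event u (Pass (u, v) (Some a)) H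
          in if Q' ((u, v), a) then return_pmf (H', M)
             else process_seq G z \<psi> Q Q' s (H', M))
     }"

text \<open>
  An edge at \<open>v\<close> that has not received a suggestion by the end of the processing of \<open>v\<close> arrives at
  its scheme with the default suggestion (none). Doing this at the end is immaterial, since every
  scheme sees exactly one element per vertex \<open>v\<close>.
\<close>

definition default_arrivals ::
  "('u, 'v, 'a) qc_instance \<Rightarrow> 'v \<Rightarrow> ('u, 'v, 'a) policy_state \<Rightarrow> ('u, 'v, 'a) policy_state"
where
  "default_arrivals G v = (\<lambda>(H, M).
     (\<lambda>u. if (u, v) \<in> edges G \<and> (u, v) \<notin> ev_elem ` set (H u)
          then H u @ [Pass (u, v) None] else H u, M))"

primrec process_vertices ::
  "('u, 'v, 'a) qc_instance \<Rightarrow> ('u, 'v, 'a) lp_var \<Rightarrow> ('u \<Rightarrow> ('u \<times> 'v, 'a) prcrs) \<Rightarrow>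
   (('u \<times> 'v) \<times> 'a \<Rightarrow> bool) \<Rightarrow> (('u \<times> 'v) \<times> 'a \<Rightarrow> bool) \<Rightarrow>
   'v list \<Rightarrow> ('u, 'v, 'a) policy_state \<Rightarrow> ('u, 'v, 'a) policy_state pmf"
where
  "process_vertices G z \<psi> Q Q' [] st = return_pmf st"
| "process_vertices G z \<psi> Q Q' (v # vs) st =
     do {
       c \<leftarrow> sub_draw (query_seqs G v) (z v);
       st' \<leftarrow> process_seq G z \<psi> Q Q' (case c of None \<Rightarrow> [] | Some s \<Rightarrow> s) st;
       process_vertices G z \<psi> Q Q' vs (default_arrivals G v st')
     }"

definition rounding_policy ::
  "('u, 'v, 'a) qc_instance \<Rightarrow> ('u, 'v, 'a) lp_var \<Rightarrow> ('u \<Rightarrow> ('u \<times> 'v, 'a) prcrs) \<Rightarrow>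
   (('u \<times> 'v) \<times> 'a) set pmf"
where
  "rounding_policy G z \<psi> =
     do {
       Q \<leftarrow> Pi_pmf (edges G \<times> acts G) False (\<lambda>(e, a). bernoulli_pmf (qprob G e a));
       Q' \<leftarrow> Pi_pmf (edges G \<times> acts G) False (\<lambda>(e, a). bernoulli_pmf (qprob G e a));
       \<pi> \<leftarrow> pmf_of_set (permutations_of_set (right G));
       (H, M) \<leftarrow> process_vertices G z \<psi> Q Q' \<pi> (\<lambda>_. [], {});
       return_pmf M
     }"

definition matching_reward :: "('u, 'v, 'a) qc_instance \<Rightarrow> (('u \<times> 'v) \<times> 'a) set \<Rightarrow> real" where
  "matching_reward G M = (\<Sum>(e, a)\<in>M. reward G e a)"

definition expected_reward ::
  "('u, 'v, 'a) qc_instance \<Rightarrow> (('u \<times> 'v) \<times> 'a) set pmf \<Rightarrow> real"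
where
  "expected_reward G p = measure_pmf.expectation p (matching_reward G)"

end

theory Submission
  imports Defs
begin

text \<open>
  Fix \<open>u\<close> and reveal every coin only when it is looked at. Whether or not the scheme at \<open>u\<close> queries
  \<open>e\<close> via \<open>a\<close>, the policy then stops processing \<open>v\<close> with probability exactly \<open>q\<^sub>e(a)\<close>: the dummy
  coin \<open>Q'\<close> replaces the missing query. Hence the edge \<open>(u, v)\<close> receives suggestion \<open>a\<close> with
  probability \<open>z_tilde G z (u, v) a\<close>, independently of the past and of all decisions made at other
  vertices, so the history of the scheme at \<open>u\<close> has the law of a genuine P-RCRS experiment on its
  induced input (which is valid by the constraints of (LP-C)). Selectability bounds the probability
  that \<open>e\<close> is queried via \<open>a\<close>; the query succeeds with a fresh coin of bias \<open>q\<^sub>e(a)\<close>; linearity of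
  expectation concludes.
\<close>

section \<open>Deferred decisions\<close>

text \<open>Coordinates of a product are independent, so the entry at \<open>x\<close> can be drawn
  first. As the second argument of \<open>F\<close> is never read at \<open>x\<close>, a whole fresh
  table may be drawn afterwards instead of one on \<open>A - {x}\<close>; this keeps the product in
  the shape that the inductions need.\<close>

lemma bind_Pi_pmf_reveal:
  assumes "finite A" "x \<in> A" "\<And>b f c. F b (f(x := c)) = F b f"
  shows "bind_pmf (Pi_pmf A d p) (\<lambda>f. F (f x) f) =
           bind_pmf (p x) (\<lambda>b. bind_pmf (Pi_pmf A d p) (F b))"
proof -
  define B where "B = A - {x}"
  have A: "A = insert x B" "finite B" "x \<notin> B"
    using assms by (auto simp: B_def)
  show ?thesis
    by (simp add: A Pi_pmf_insert' bind_assoc_pmf bind_return_pmf assms(3))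
qed

text \<open>
  The coin for the state is flipped even without a query. It is then ignored, but this keeps the
  coins of a run independent of the decisions.
\<close>

definition resolve_arrival ::
  "('i, 'a) prcrs \<Rightarrow> ('i, 'a) prcrs_input \<Rightarrow> ('i, 'a) event list \<Rightarrow> 'i \<Rightarrow> 'a option \<Rightarrow>
   ('i, 'a) event list pmf"
where
  "resolve_arrival \<psi> I h i s =
     do {
       b \<leftarrow> scheme_decision \<psi> I h i s;
       c \<leftarrow> bernoulli_pmf (in_state_prob I i (the s));
       return_pmf (h @ [if b then Query i (the s) c else Pass i s])
     }"

primrec lazy_run ::
  "('i, 'a) prcrs \<Rightarrow> ('i, 'a) prcrs_input \<Rightarrow> 'i list \<Rightarrow> ('i, 'a) event list \<Rightarrow>
   ('i, 'a) event list pmf"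
where
  "lazy_run \<psi> I [] h = return_pmf h"
| "lazy_run \<psi> I (i # is) h =
     do {
       s \<leftarrow> sub_draw (in_actions I) (in_sugg_prob I i);
       h' \<leftarrow> resolve_arrival \<psi> I h i s;
       lazy_run \<psi> I is h'
     }"

lemma scheme_decision_None [simp]: "scheme_decision \<psi> I h i None = return_pmf False"
  by (simp add: scheme_decision_def)

text \<open>States are compared only at suggested actions, since a run reads no others. This makes
  updates of the tables at elements that have already arrived invisible.\<close>

lemma prcrs_run_cong:
  assumes "\<And>i. i \<in> set \<sigma> \<Longrightarrow> X i = X' i"
    and "\<And>i. i \<in> set \<sigma> \<Longrightarrow> X i \<noteq> None \<Longrightarrow> P (i, the (X i)) = P' (i, the (X i))"
  shows "prcrs_run \<psi> I P X \<sigma> h = prcrs_run \<psi> I P' X' \<sigma> h"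
  using assms
proof (induction \<sigma> arbitrary: h)
  case (Cons i \<sigma>)
  show ?case
  proof (cases "X i")
    case None
    then show ?thesis using Cons.IH Cons.prems by (auto simp: bind_return_pmf)
  next
    case (Some a)
    then have "P (i, a) = P' (i, a)" "X' i = Some a"
      using Cons.prems(1)[of i] Cons.prems(2)[of i] by auto
    then show ?thesis using Some Cons.IH Cons.prems by (auto cong: if_cong)
  qed
qed simp

text \<open>Total mass at most 1 is the condition under which \<open>embed_spmf\<close> returns the
  prescribed weights.\<close>

lemma spmf_sub_draw:
  assumes "finite S" "\<And>s. s \<in> S \<Longrightarrow> 0 \<le> w s" "sum w S \<le> 1"
  shows "spmf (sub_draw S w) s = (if s \<in> S then w s else 0)"
proof -
  have "(\<integral>\<^sup>+ x. ennreal (if x \<in> S then w x else 0) \<partial>count_space UNIV)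
          = (\<integral>\<^sup>+ x. ennreal (w x) \<partial>count_space S)"
    by (subst (2) nn_integral_count_space_indicator)
       (auto intro!: nn_integral_cong split: split_indicator)
  also have "\<dots> = ennreal (sum w S)"
    using assms(1,2) by (simp add: nn_integral_count_space_finite sum_ennreal)
  also have "\<dots> \<le> 1"
    using assms(3) by simp
  finally show ?thesis
    using assms(2) by (simp add: sub_draw_def)
qed

lemma set_pmf_sub_draw:
  assumes "finite S" "\<And>s. s \<in> S \<Longrightarrow> 0 \<le> w s" "sum w S \<le> 1"
  shows "set_pmf (sub_draw S w) \<subseteq> insert None (Some ` S)"
proof
  fix x assume "x \<in> set_pmf (sub_draw S w)"
  then show "x \<in> insert None (Some ` S)"
    using spmf_sub_draw[OF assms] by (cases x) (auto simp: set_pmf_iff split: if_splits)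
qed

text \<open>Induction over the arrivals: the suggestion and then the state of the first element are
  revealed at their only use. As elements are distinct, the rest of the run never reads these
  entries, so both tables can be redrawn in full for the induction hypothesis.\<close>

lemma prcrs_run_deferred:
  assumes I: "valid_input I" and \<sigma>: "distinct \<sigma>" "set \<sigma> \<subseteq> in_elems I"
  shows
    "do {
       P \<leftarrow> Pi_pmf (in_elems I \<times> in_actions I) False (\<lambda>(i, a). bernoulli_pmf (in_state_prob I i a));
       X \<leftarrow> Pi_pmf (in_elems I) None (\<lambda>i. sub_draw (in_actions I) (in_sugg_prob I i));
       prcrs_run \<psi> I P X \<sigma> h
     } = lazy_run \<psi> I \<sigma> h"
  using \<sigma>
proof (induction \<sigma> arbitrary: h)
  case (Cons i \<sigma>)
  let ?PP = "Pi_pmf (in_elems I \<times> in_actions I) False (\<lambda>(i, a). bernoulli_pmf (in_state_prob I i a))"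
  let ?PX = "Pi_pmf (in_elems I) None (\<lambda>i. sub_draw (in_actions I) (in_sugg_prob I i))"
  have fin: "finite (in_elems I)" "finite (in_elems I \<times> in_actions I)" "finite (in_actions I)"
    using I by (auto simp: valid_input_def)
  have i: "i \<in> in_elems I" "i \<notin> set \<sigma>" using Cons.prems by auto
  have supp: "set_pmf (sub_draw (in_actions I) (in_sugg_prob I i)) \<subseteq> insert None (Some ` in_actions I)"
    using I i by (intro set_pmf_sub_draw) (auto simp: valid_input_def)
  let ?h = "\<lambda>s b c. h @ [if b then Query i (the s) c else Pass i s]"
  have indepX: "prcrs_run \<psi> I P (X(i := s)) \<sigma> h' = prcrs_run \<psi> I P X \<sigma> h'" for P X s h'
    using i by (intro prcrs_run_cong) auto
  have indepP: "prcrs_run \<psi> I (P((i, a) := c)) X \<sigma> h' = prcrs_run \<psi> I P X \<sigma> h'" for P X a c h'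
    using i by (intro prcrs_run_cong) auto
  have "do {P \<leftarrow> ?PP; X \<leftarrow> ?PX; prcrs_run \<psi> I P X (i # \<sigma>) h} =
        do {P \<leftarrow> ?PP; X \<leftarrow> ?PX; b \<leftarrow> scheme_decision \<psi> I h i (X i);
            prcrs_run \<psi> I P X \<sigma> (?h (X i) b (P (i, the (X i))))}"
    by simp
  also have "\<dots> = do {P \<leftarrow> ?PP; s \<leftarrow> sub_draw (in_actions I) (in_sugg_prob I i); X \<leftarrow> ?PX;
                      b \<leftarrow> scheme_decision \<psi> I h i s;
                      prcrs_run \<psi> I P X \<sigma> (?h s b (P (i, the s)))}"
  proof (intro bind_pmf_cong refl)
    fix P
    show "do {X \<leftarrow> ?PX; b \<leftarrow> scheme_decision \<psi> I h i (X i);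
              prcrs_run \<psi> I P X \<sigma> (?h (X i) b (P (i, the (X i))))} =
          do {s \<leftarrow> sub_draw (in_actions I) (in_sugg_prob I i); X \<leftarrow> ?PX;
              b \<leftarrow> scheme_decision \<psi> I h i s; prcrs_run \<psi> I P X \<sigma> (?h s b (P (i, the s)))}"
      by (rule bind_Pi_pmf_reveal[where F = "\<lambda>s X. do {b \<leftarrow> scheme_decision \<psi> I h i s;
             prcrs_run \<psi> I P X \<sigma> (?h s b (P (i, the s)))}"]) (use i fin in \<open>auto simp: indepX\<close>)
  qed
  also have "\<dots> = do {s \<leftarrow> sub_draw (in_actions I) (in_sugg_prob I i);
                      b \<leftarrow> scheme_decision \<psi> I h i s; P \<leftarrow> ?PP; X \<leftarrow> ?PX;
                      prcrs_run \<psi> I P X \<sigma> (?h s b (P (i, the s)))}"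
    by (simp add: bind_commute_pmf[of ?PP "sub_draw (in_actions I) (in_sugg_prob I i)"]
          bind_commute_pmf[where A = ?PX and B = "scheme_decision \<psi> I h i s" for s]
          bind_commute_pmf[where A = ?PP and B = "scheme_decision \<psi> I h i s" for s])
  also have "\<dots> = do {s \<leftarrow> sub_draw (in_actions I) (in_sugg_prob I i);
                      b \<leftarrow> scheme_decision \<psi> I h i s;
                      c \<leftarrow> bernoulli_pmf (in_state_prob I i (the s)); P \<leftarrow> ?PP; X \<leftarrow> ?PX;
                      prcrs_run \<psi> I P X \<sigma> (?h s b c)}"
  proof (intro bind_pmf_cong refl)
    fix s b assume s: "s \<in> set_pmf (sub_draw (in_actions I) (in_sugg_prob I i))"
    show "do {P \<leftarrow> ?PP; X \<leftarrow> ?PX; prcrs_run \<psi> I P X \<sigma> (?h s b (P (i, the s)))} =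
          do {c \<leftarrow> bernoulli_pmf (in_state_prob I i (the s)); P \<leftarrow> ?PP; X \<leftarrow> ?PX;
              prcrs_run \<psi> I P X \<sigma> (?h s b c)}" if b: "b \<in> set_pmf (scheme_decision \<psi> I h i s)"
    \<comment> \<open>A suggested action lies in \<open>in_actions I\<close>, so its state is an
      entry of the table and can be revealed. Without a suggestion the decision is surely
      \<open>False\<close>, and the extra coin \<open>c\<close> is ignored whatever its
      bias.\<close>
    proof (cases s)
      case (Some a)
      then have "a \<in> in_actions I" using s supp by auto
      then show ?thesis
        using bind_Pi_pmf_reveal[where x = "(i, a)" and A = "in_elems I \<times> in_actions I" and
              F = "\<lambda>c P. do {X \<leftarrow> ?PX; prcrs_run \<psi> I P X \<sigma> (?h s b c)}"
              and p = "\<lambda>(i, a). bernoulli_pmf (in_state_prob I i a)" and d = False] i fin Some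
        by (simp add: indepP cong: if_cong)
    qed (use b in auto)
  qed
  also have "\<dots> = lazy_run \<psi> I (i # \<sigma>) h"
    using Cons by (simp add: resolve_arrival_def bind_assoc_pmf bind_return_pmf)
  finally show ?case .
qed simp

section \<open>Deferring the coins of the rounding policy\<close>

abbreviation coin_table :: "('u, 'v, 'a) qc_instance \<Rightarrow> (('u \<times> 'v) \<times> 'a \<Rightarrow> bool) pmf" where
  "coin_table G \<equiv> Pi_pmf (edges G \<times> acts G) False (\<lambda>(e, a). bernoulli_pmf (qprob G e a))"

text \<open>
  In the following two definitions \<open>b\<close> is the decision of the scheme, and the single fresh coin \<open>c\<close>
  plays the role of \<open>Q\<close> if \<open>b\<close> holds and of \<open>Q'\<close> otherwise.
\<close>

definition after_query ::
  "('u \<times> 'v) \<times> 'a \<Rightarrow> bool \<Rightarrow> bool \<Rightarrow> ('u, 'v, 'a) policy_state \<Rightarrow> ('u, 'v, 'a) policy_state"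
where
  "after_query x b c st = (case (x, st) of ((e, a), (H, M)) \<Rightarrow>
     (record_event (fst e) (if b then Query e a c else Pass e (Some a)) H,
      if b \<and> c then insert x M else M))"

fun lazy_seq ::
  "('u, 'v, 'a) qc_instance \<Rightarrow> ('u, 'v, 'a) lp_var \<Rightarrow> ('u \<Rightarrow> ('u \<times> 'v, 'a) prcrs) \<Rightarrow>
   (('u \<times> 'v) \<times> 'a) list \<Rightarrow> ('u, 'v, 'a) policy_state \<Rightarrow> ('u, 'v, 'a) policy_state pmf"
where
  "lazy_seq G z \<psi> [] st = return_pmf st"
| "lazy_seq G z \<psi> ((e, a) # s) st =
     do {
       b \<leftarrow> scheme_decision (\<psi> (fst e)) (induced_input G z (fst e)) (fst st (fst e)) e (Some a);
       c \<leftarrow> bernoulli_pmf (qprob G e a);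
       if c then return_pmf (after_query (e, a) b c st)
       else lazy_seq G z \<psi> s (after_query (e, a) b c st)
     }"

primrec lazy_vertices ::
  "('u, 'v, 'a) qc_instance \<Rightarrow> ('u, 'v, 'a) lp_var \<Rightarrow> ('u \<Rightarrow> ('u \<times> 'v, 'a) prcrs) \<Rightarrow>
   'v list \<Rightarrow> ('u, 'v, 'a) policy_state \<Rightarrow> ('u, 'v, 'a) policy_state pmf"
where
  "lazy_vertices G z \<psi> [] st = return_pmf st"
| "lazy_vertices G z \<psi> (v # vs) st =
     do {
       c \<leftarrow> sub_draw (query_seqs G v) (z v);
       st' \<leftarrow> lazy_seq G z \<psi> (case c of None \<Rightarrow> [] | Some s \<Rightarrow> s) st;
       lazy_vertices G z \<psi> vs (default_arrivals G v st')
     }"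

text \<open>Both branches of \<open>process_seq\<close> take one form: the coin is looked up in
  \<open>Q\<close> or \<open>Q'\<close> according to \<open>b\<close>, but stopping depends on its
  value alone.\<close>

lemma process_seq_Cons:
  "process_seq G z \<psi> Q Q' ((e, a) # s) st =
     do {
       b \<leftarrow> scheme_decision (\<psi> (fst e)) (induced_input G z (fst e)) (fst st (fst e)) e (Some a);
       let c = (if b then Q (e, a) else Q' (e, a));
       if c then return_pmf (after_query (e, a) b c st)
       else process_seq G z \<psi> Q Q' s (after_query (e, a) b c st)
     }"
  by (cases e; cases st) (auto simp: after_query_def Let_def intro!: bind_pmf_cong)

lemma process_seq_cong:
  assumes "\<And>x. x \<in> set s \<Longrightarrow> Q1 x = Q2 x" "\<And>x. x \<in> set s \<Longrightarrow> Q1' x = Q2' x"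
  shows "process_seq G z \<psi> Q1 Q1' s st = process_seq G z \<psi> Q2 Q2' s st"
  using assms
proof (induction s arbitrary: st)
  case Nil
  show ?case by (cases st) simp
next
  case (Cons x s)
  obtain e a where x: "x = (e, a)" by (cases x)
  have "process_seq G z \<psi> Q1 Q1' s st = process_seq G z \<psi> Q2 Q2' s st" for st
    using Cons by auto
  moreover have "Q1 (e, a) = Q2 (e, a)" "Q1' (e, a) = Q2' (e, a)" using Cons.prems x by auto
  ultimately show ?case by (simp add: x process_seq_Cons Let_def del: process_seq.simps cong: if_cong)
qed

lemma finite_edges:
  assumes "valid_instance G"
  shows "finite (edges G)" "finite (edges G \<times> acts G)"
proof -
  show "finite (edges G)"
    by (rule finite_subset[of _ "left G \<times> right G"]) (use assms in \<open>auto simp: valid_instance_def\<close>)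
  then show "finite (edges G \<times> acts G)"
    using assms by (auto simp: valid_instance_def)
qed

text \<open>The edges of a sequence are distinct, so only finitely many lists qualify even under
  infinite patience.\<close>

lemma finite_query_seqs:
  assumes "valid_instance G"
  shows "finite (query_seqs G v)"
proof -
  have "finite (edges_at_right G v \<times> acts G)"
    by (rule finite_subset[OF _ finite_edges(2)[OF assms]]) (auto simp: edges_at_right_def)
  moreover have "query_seqs G v \<subseteq> {s. set s \<subseteq> edges_at_right G v \<times> acts G \<and> distinct s}"
    by (auto simp: query_seqs_def distinct_map)
  ultimately show ?thesis
    by (auto intro: finite_subset[OF _ finite_subset_distinct])
qed

lemma query_seqs_drawn:
  assumes "valid_instance G" "LPC_feasible G z" "v \<in> right G"
    and "c \<in> set_pmf (sub_draw (query_seqs G v) (z v))"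
  shows "(case c of None \<Rightarrow> [] | Some s \<Rightarrow> s) \<in> query_seqs G v"
proof -
  have "c \<in> insert None (Some ` query_seqs G v)"
    using assms set_pmf_sub_draw[OF finite_query_seqs[OF assms(1)], of v "z v"]
    by (auto simp: LPC_feasible_def)
  then show ?thesis by (auto simp: query_seqs_def zero_enat_def[symmetric])
qed

text \<open>A sequence drawn at \<open>v\<close> uses only edges at \<open>v\<close>, so coins
  belonging to right vertices outside \<open>vs\<close> are never read.\<close>

lemma process_vertices_cong:
  assumes "valid_instance G" "LPC_feasible G z" "set vs \<subseteq> right G"
    and "\<And>e a. snd e \<in> set vs \<Longrightarrow> Q1 (e, a) = Q2 (e, a)"
    and "\<And>e a. snd e \<in> set vs \<Longrightarrow> Q1' (e, a) = Q2' (e, a)"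
  shows "process_vertices G z \<psi> Q1 Q1' vs st = process_vertices G z \<psi> Q2 Q2' vs st"
  using assms(3-)
proof (induction vs arbitrary: st)
  case (Cons v vs)
  have *: "process_vertices G z \<psi> Q1 Q1' vs st = process_vertices G z \<psi> Q2 Q2' vs st" for st
    using Cons by auto
  have "process_seq G z \<psi> Q1 Q1' (case c of None \<Rightarrow> [] | Some s \<Rightarrow> s) st =
        process_seq G z \<psi> Q2 Q2' (case c of None \<Rightarrow> [] | Some s \<Rightarrow> s) st"
    if "c \<in> set_pmf (sub_draw (query_seqs G v) (z v))" for c st
    using query_seqs_drawn[OF assms(1,2) _ that] Cons.prems
    by (intro process_seq_cong) (fastforce simp: query_seqs_def edges_at_right_def)+
  then show ?case by (simp add: * cong: bind_pmf_cong_simp)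
qed simp

text \<open>\<open>K\<close> stands for the remainder of the run. It ignores the coins of
  \<open>s\<close>, and the entries of \<open>s\<close> are distinct, so a coin can be revealed when
  it is looked at and both tables passed on to \<open>K\<close> as if untouched.\<close>

lemma process_seq_deferred:
  assumes "finite (edges G \<times> acts G)" "distinct s" "set s \<subseteq> edges G \<times> acts G"
    and K: "\<And>Q Q' x b st'. x \<in> set s \<Longrightarrow> K (Q(x := b)) Q' st' = K Q Q' st'"
           "\<And>Q Q' x b st'. x \<in> set s \<Longrightarrow> K Q (Q'(x := b)) st' = K Q Q' st'"
  shows "do {Q \<leftarrow> coin_table G; Q' \<leftarrow> coin_table G; st' \<leftarrow> process_seq G z \<psi> Q Q' s st; K Q Q' st'} =
         do {st' \<leftarrow> lazy_seq G z \<psi> s st; Q \<leftarrow> coin_table G; Q' \<leftarrow> coin_table G; K Q Q' st'}"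
  using assms(2-)
proof (induction s arbitrary: st)
  case Nil
  show ?case by (cases st) (simp add: bind_return_pmf)
next
  case (Cons x s)
  obtain e a where x: "x = (e, a)" by (cases x)
  let ?D = "scheme_decision (\<psi> (fst e)) (induced_input G z (fst e)) (fst st (fst e)) e (Some a)"
  let ?B = "bernoulli_pmf (qprob G e a)"
  let ?next = "\<lambda>b c. after_query (e, a) b c st"
  define F where "F b c Q Q' =
    (if c then K Q Q' (?next b c) else process_seq G z \<psi> Q Q' s (?next b c) \<bind> K Q Q')" for b c Q Q'
  have xin: "x \<in> edges G \<times> acts G" and xs: "x \<notin> set s" using Cons.prems by auto
  have K1: "K (Q(x := b)) Q' = K Q Q'" and K2: "K Q (Q'(x := b)) = K Q Q'" for Q Q' b
    by (rule ext, rule Cons.prems(3,4), simp)+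
  have P1: "process_seq G z \<psi> (Q(x := b)) Q' s = process_seq G z \<psi> Q Q' s" for Q Q' b
    by (intro ext process_seq_cong) (use xs in auto)
  have P2: "process_seq G z \<psi> Q (Q'(x := b)) s = process_seq G z \<psi> Q Q' s" for Q Q' b
    by (intro ext process_seq_cong) (use xs in auto)
  have F1: "F b c (Q(x := d)) = F b c Q" and F2: "F b c Q (Q'(x := d)) = F b c Q Q'"
    for b c d Q Q'
    unfolding fun_eq_iff by (simp_all only: F_def K1 K2 P1 P2 simp_thms)
  have "do {Q \<leftarrow> coin_table G; Q' \<leftarrow> coin_table G;
            st' \<leftarrow> process_seq G z \<psi> Q Q' (x # s) st; K Q Q' st'} =
        do {Q \<leftarrow> coin_table G; Q' \<leftarrow> coin_table G; b \<leftarrow> ?D; F b (if b then Q x else Q' x) Q Q'}"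
    by (simp add: x process_seq_Cons F_def bind_assoc_pmf Let_def if_distrib[of "\<lambda>p. bind_pmf p _"]
          bind_return_pmf del: process_seq.simps cong: if_cong)
  also have "\<dots> = do {b \<leftarrow> ?D; Q \<leftarrow> coin_table G; Q' \<leftarrow> coin_table G; F b (if b then Q x else Q' x) Q Q'}"
    by (simp add: bind_commute_pmf[of "coin_table G" ?D])
  also have "\<dots> = do {b \<leftarrow> ?D; c \<leftarrow> ?B; Q \<leftarrow> coin_table G; Q' \<leftarrow> coin_table G; F b c Q Q'}"
  proof (intro bind_pmf_cong refl)
    fix b
    show "do {Q \<leftarrow> coin_table G; Q' \<leftarrow> coin_table G; F b (if b then Q x else Q' x) Q Q'} =
          do {c \<leftarrow> ?B; Q \<leftarrow> coin_table G; Q' \<leftarrow> coin_table G; F b c Q Q'}"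
    \<comment> \<open>With a query the coin comes from \<open>Q\<close>, otherwise from
      \<open>Q'\<close>. Both entries have bias \<open>qprob G e a\<close>, so one fresh coin serves
      for either; in the second case it still has to be moved in front of the draw of
      \<open>Q\<close>.\<close>
    proof (cases b)
      case True
      then show ?thesis
        using bind_Pi_pmf_reveal[OF assms(1) xin, where d = False
            and p = "\<lambda>(e, a). bernoulli_pmf (qprob G e a)"
            and F = "\<lambda>c Q. do {Q' \<leftarrow> coin_table G; F True c Q Q'}"]
        by (simp add: F1[unfolded x] x)
    next
      case False
      have "do {Q' \<leftarrow> coin_table G; F False (Q' x) Q Q'} =
            do {c \<leftarrow> ?B; Q' \<leftarrow> coin_table G; F False c Q Q'}" for Q
        using bind_Pi_pmf_reveal[OF assms(1) xin, where d = False
            and p = "\<lambda>(e, a). bernoulli_pmf (qprob G e a)" and F = "\<lambda>c Q'. F False c Q Q'"]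
        by (simp add: F2[unfolded x] x)
      then show ?thesis
        using False by (simp add: bind_commute_pmf[of "coin_table G" ?B])
    qed
  qed
  also have "\<dots> = do {b \<leftarrow> ?D; c \<leftarrow> ?B;
      st' \<leftarrow> (if c then return_pmf (?next b c) else lazy_seq G z \<psi> s (?next b c));
      Q \<leftarrow> coin_table G; Q' \<leftarrow> coin_table G; K Q Q' st'}"
  proof (intro bind_pmf_cong refl)
    fix b c
    show "do {Q \<leftarrow> coin_table G; Q' \<leftarrow> coin_table G; F b c Q Q'} =
      do {st' \<leftarrow> (if c then return_pmf (?next b c) else lazy_seq G z \<psi> s (?next b c));
          Q \<leftarrow> coin_table G; Q' \<leftarrow> coin_table G; K Q Q' st'}"
      using Cons.IH[of "?next b c"] Cons.prems by (cases c) (simp_all add: F_def bind_return_pmf)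
  qed
  finally show ?case by (simp add: x bind_assoc_pmf)
qed

text \<open>Edges at \<open>v\<close> do not occur at later right vertices, so the rest of the run
  can serve as the continuation \<open>K\<close> of \<open>process_seq_deferred\<close>.\<close>

lemma process_vertices_deferred:
  assumes "valid_instance G" "LPC_feasible G z" "distinct vs" "set vs \<subseteq> right G"
  shows "do {Q \<leftarrow> coin_table G; Q' \<leftarrow> coin_table G; process_vertices G z \<psi> Q Q' vs st} =
         lazy_vertices G z \<psi> vs st"
  using assms(3,4)
proof (induction vs arbitrary: st)
  case (Cons v vs)
  have fin: "finite (edges G \<times> acts G)"
    using assms(1) by (rule finite_edges)
  let ?s = "\<lambda>c. case c of None \<Rightarrow> [] | Some s \<Rightarrow> s"
  let ?S = "sub_draw (query_seqs G v) (z v)"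
  have "do {Q \<leftarrow> coin_table G; Q' \<leftarrow> coin_table G; process_vertices G z \<psi> Q Q' (v # vs) st} =
        do {c \<leftarrow> ?S; Q \<leftarrow> coin_table G; Q' \<leftarrow> coin_table G; st' \<leftarrow> process_seq G z \<psi> Q Q' (?s c) st;
            process_vertices G z \<psi> Q Q' vs (default_arrivals G v st')}"
    by (simp add: bind_commute_pmf[of "coin_table G" ?S])
  also have "\<dots> = do {c \<leftarrow> ?S; st' \<leftarrow> lazy_seq G z \<psi> (?s c) st; Q \<leftarrow> coin_table G; Q' \<leftarrow> coin_table G;
            process_vertices G z \<psi> Q Q' vs (default_arrivals G v st')}"
  proof (intro bind_pmf_cong refl process_seq_deferred fin)
    fix c assume "c \<in> set_pmf ?S"
    then have s: "?s c \<in> query_seqs G v" 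
      using query_seqs_drawn[OF assms(1,2)] Cons.prems by auto
    show "distinct (?s c)" "set (?s c) \<subseteq> edges G \<times> acts G"
      using s by (auto simp: query_seqs_def distinct_map edges_at_right_def)
    fix Q Q' x b st'
    assume "x \<in> set (?s c)"
    then have "snd (fst x) \<notin> set vs"
      using s Cons.prems by (auto simp: query_seqs_def edges_at_right_def)
    then show "process_vertices G z \<psi> (Q(x := b)) Q' vs (default_arrivals G v st') =
          process_vertices G z \<psi> Q Q' vs (default_arrivals G v st')"
      "process_vertices G z \<psi> Q (Q'(x := b)) vs (default_arrivals G v st') =
          process_vertices G z \<psi> Q Q' vs (default_arrivals G v st')"
      using Cons.prems
      by (auto intro!: process_vertices_cong[OF assms(1,2)] split: if_splits)
  qed
  also have "\<dots> = lazy_vertices G z \<psi> (v # vs) st"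
    using Cons by simp
  finally show ?case .
qed simp

section \<open>The history of a single scheme\<close>

lemma fst_after_query:
  "fst (after_query (e, a) b c st) u =
     (if u = fst e then fst st u @ [if b then Query e a c else Pass e (Some a)] else fst st u)"
  by (cases st) (simp add: after_query_def record_event_def)

lemma snd_after_query:
  "snd (after_query x b c st) = (if b \<and> c then insert x (snd st) else snd st)"
  by (cases st; cases x) (simp add: after_query_def)

lemma fst_default_arrivals:
  "fst (default_arrivals G v st) u =
     (if (u, v) \<in> edges G \<and> (u, v) \<notin> ev_elem ` set (fst st u)
      then fst st u @ [Pass (u, v) None] else fst st u)"
  by (cases st) (simp add: default_arrivals_def)

lemma snd_default_arrivals [simp]: "snd (default_arrivals G v st) = snd st"
  by (cases st) (simp add: default_arrivals_def)

lemma lazy_seq_other: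
  assumes "st' \<in> set_pmf (lazy_seq G z \<psi> s st)" "u \<notin> fst ` fst ` set s"
  shows "fst st' u = fst st u"
  using assms
proof (induction s arbitrary: st)
  case (Cons x s)
  obtain e a where x: "x = (e, a)" by (cases x)
  have after: "fst (after_query (e, a) b c st) u = fst st u" for b c
    using Cons.prems(2) by (auto simp: fst_after_query x)
  from Cons.prems(1) obtain b c where
    "st' = after_query (e, a) b c st \<or> st' \<in> set_pmf (lazy_seq G z \<psi> s (after_query (e, a) b c st))"
    by (auto simp: x split: if_splits)
  then show ?case
    using after[of b c] Cons.IH[of "after_query (e, a) b c st"] Cons.prems(2) by auto
qed simp

lemma lazy_seq_elems:
  assumes "st' \<in> set_pmf (lazy_seq G z \<psi> s st)"
  shows "ev_elem ` set (fst st' u) \<subseteq> ev_elem ` set (fst st u) \<union> fst ` set s"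
  using assms
proof (induction s arbitrary: st)
  case (Cons x s)
  obtain e a where x: "x = (e, a)" by (cases x)
  have after: "ev_elem ` set (fst (after_query (e, a) b c st) u) \<subseteq> insert e (ev_elem ` set (fst st u))" for b c
    by (auto simp: fst_after_query)
  from Cons.prems obtain b c where
    "st' = after_query (e, a) b c st \<or> st' \<in> set_pmf (lazy_seq G z \<psi> s (after_query (e, a) b c st))"
    by (auto simp: x split: if_splits)
  then show ?case
    using after[of b c] Cons.IH[of "after_query (e, a) b c st"] by (auto simp: x)
qed simp

lemma map_pmf_constant:
  assumes "\<And>x. x \<in> set_pmf p \<Longrightarrow> f x = y"
  shows "map_pmf f p = return_pmf y"
  using assms by (simp cong: map_pmf_cong)

lemma resolve_arrival_None [simp]:
  "resolve_arrival \<psi> I h i None = return_pmf (h @ [Pass i None])"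
  by (simp add: resolve_arrival_def bind_return_pmf)

text \<open>The suggestion that the edge \<open>e\<close> receives while the given sequence is processed.\<close>

fun seq_suggestion ::
  "('u, 'v, 'a) qc_instance \<Rightarrow> 'u \<times> 'v \<Rightarrow> (('u \<times> 'v) \<times> 'a) list \<Rightarrow> 'a option pmf"
where
  "seq_suggestion G e [] = return_pmf None"
| "seq_suggestion G e ((e', a) # s) =
     (if e' = e then return_pmf (Some a)
      else do {
        c \<leftarrow> bernoulli_pmf (qprob G e' a);
        if c then return_pmf None else seq_suggestion G e s
      })"

text \<open>Until \<open>e\<close> is reached, the policy stops or continues by fresh coins alone,
  and the other edges of \<open>s\<close> end at left vertices different from \<open>u\<close>. The
  decisions of the other schemes therefore drop out, and \<open>u\<close> sees a single arrival
  whose suggestion is independent of its history.\<close>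

lemma lazy_seq_marginal:
  assumes "e = (u, v)" "e \<in> edges G"
    and "distinct (map fst s)" "\<And>x. x \<in> set s \<Longrightarrow> snd (fst x) = v"
    and "e \<notin> ev_elem ` set (fst st u)"
  shows "map_pmf (\<lambda>st'. fst (default_arrivals G v st') u) (lazy_seq G z \<psi> s st) =
         bind_pmf (seq_suggestion G e s) (resolve_arrival (\<psi> u) (induced_input G z u) (fst st u) e)"
  using assms(3-)
proof (induction s arbitrary: st)
  case Nil
  then show ?case
    using assms(1,2) by (simp add: bind_return_pmf fst_default_arrivals)
next
  case (Cons x s)
  obtain e' a where x: "x = (e', a)" by (cases x)
  have v: "snd e' = v" using Cons.prems(2)[of x] x by simp
  let ?f = "\<lambda>st'. fst (default_arrivals G v st') u"
  show ?case
  proof (cases "e' = e")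
    case True
    \<comment> \<open>Distinct edges at the same \<open>v\<close> have distinct left endpoints, so
      nothing after \<open>e\<close> concerns \<open>u\<close>.\<close>
    have u: "u \<notin> fst ` fst ` set s"
    proof
      assume "u \<in> fst ` fst ` set s"
      then obtain y where "y \<in> set s" "fst (fst y) = u" by auto
      with Cons.prems(1) Cons.prems(2)[of y] True assms(1) x show False
        by (cases y) force
    qed
    \<comment> \<open>Stopping and continuing now give the same history at \<open>u\<close>: one new
      event, with \<open>c\<close> as the revealed state in case of a query.\<close>
    have "map_pmf ?f (if c then return_pmf (after_query (e, a) b c st)
                      else lazy_seq G z \<psi> s (after_query (e, a) b c st)) =
          return_pmf (fst st u @ [if b then Query e a c else Pass e (Some a)])" for b c
    proof (rule map_pmf_constant)
      fix st' assume "st' \<in> set_pmf (if c then return_pmf (after_query (e, a) b c st)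
                      else lazy_seq G z \<psi> s (after_query (e, a) b c st))"
      then have "fst st' u = fst (after_query (e, a) b c st) u"
        using lazy_seq_other[OF _ u, of st'] by (cases c) auto
      then have "fst st' u = fst st u @ [if b then Query e a c else Pass e (Some a)]"
        using assms(1) by (simp add: fst_after_query)
      then show "?f st' = fst st u @ [if b then Query e a c else Pass e (Some a)]"
        using assms(1) by (simp add: fst_default_arrivals)
    qed
    moreover have "fst e = u"
      using assms(1) by simp
    ultimately show ?thesis
      using True by (simp add: x map_bind_pmf resolve_arrival_def bind_return_pmf induced_input_def
          cong: if_cong)
  next
    case False
    then have "u \<noteq> fst e'" using v assms(1) by (cases e') auto
    then have h: "fst (after_query (e', a) b c st) u = fst st u" for b c
      by (simp add: fst_after_query)
    \<comment> \<open>The decision \<open>b\<close> at another left vertex disappears: it neither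
      touches the history at \<open>u\<close> nor affects whether processing stops.\<close>
    have "map_pmf ?f (if c then return_pmf (after_query (e', a) b c st)
                      else lazy_seq G z \<psi> s (after_query (e', a) b c st)) =
          bind_pmf (if c then return_pmf None else seq_suggestion G e s)
            (resolve_arrival (\<psi> u) (induced_input G z u) (fst st u) e)" for b c
    proof (cases c)
      \<comment> \<open>Stopping early leaves \<open>e\<close> unsuggested, and
        \<open>default_arrivals\<close> then records the same \<open>Pass e None\<close> as
        \<open>resolve_arrival\<close> does for \<open>None\<close>.\<close>
      case True
      then show ?thesis
        using Cons.prems(3) h[of b True] assms(1,2)
        by (simp add: fst_default_arrivals bind_return_pmf)
    next
      case False
      have "map_pmf ?f (lazy_seq G z \<psi> s (after_query (e', a) b c st)) =
            bind_pmf (seq_suggestion G e s)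
              (resolve_arrival (\<psi> u) (induced_input G z u) (fst (after_query (e', a) b c st) u) e)"
        using Cons.prems by (intro Cons.IH) (simp_all add: h)
      with False show ?thesis by (simp add: h)
    qed
    then show ?thesis
      using False by (simp add: x map_bind_pmf bind_assoc_pmf)
  qed
qed

section \<open>The law of a suggestion, and the history it induces\<close>

lemma reach_prob_Cons:
  "reach_prob G (x # s) 0 = 1"
  "reach_prob G (x # s) (Suc i) = (1 - qprob G (fst x) (snd x)) * reach_prob G s i"
  by (simp_all add: reach_prob_def prod.lessThan_Suc_shift del: prod.lessThan_Suc)

text \<open>Each earlier coin is survived with probability one minus its bias, and these factors
  multiply to \<open>reach_prob\<close>.\<close>

lemma pmf_seq_suggestion:
  assumes "valid_instance G" "set s \<subseteq> edges G \<times> acts G" "distinct (map fst s)"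
  shows "pmf (seq_suggestion G e s) (Some a) =
         (\<Sum>i | i < length s \<and> s ! i = (e, a). reach_prob G s i)"
proof -
  have "pmf (seq_suggestion G e s) (Some a) =
        (\<Sum>i<length s. if s ! i = (e, a) then reach_prob G s i else 0)"
    using assms(2,3)
  proof (induction s)
    case (Cons x s)
    obtain e' a' where x: "x = (e', a')" by (cases x)
    have q: "0 \<le> qprob G e' a'" "qprob G e' a' \<le> 1"
      using assms(1) Cons.prems x by (auto simp: valid_instance_def)
    have shift: "(\<Sum>i<length (x # s). if (x # s) ! i = (e, a) then reach_prob G (x # s) i else 0) =
        (if x = (e, a) then 1 else 0) +
        (1 - qprob G e' a') * (\<Sum>i<length s. if s ! i = (e, a) then reach_prob G s i else 0)"
      by (simp add: sum.lessThan_Suc_shift reach_prob_Cons x sum_distrib_left if_distrib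
            del: sum.lessThan_Suc cong: if_cong)
    show ?case
    proof (cases "e' = e")
      case True
      \<comment> \<open>An edge occurs at most once, so no later position contributes, whether the
        action at the head is \<open>a\<close> or another one.\<close>
      have "(\<Sum>i<length s. if s ! i = (e, a) then reach_prob G s i else 0) = 0"
        using Cons.prems(2) True x by (intro sum.neutral) (force dest: nth_mem)
      then show ?thesis using True by (simp only: shift) (simp add: x)
    next
      case False
      then show ?thesis
        using Cons q by (simp only: shift) (simp add: x pmf_bind)
    qed
  qed simp
  also have "\<dots> = (\<Sum>i | i < length s \<and> s ! i = (e, a). reach_prob G s i)"
    by (simp add: sum.If_cases Int_def)
  finally show ?thesis .
qed

lemma spmf_suggestion:
  assumes "valid_instance G" "LPC_feasible G z" "snd e \<in> right G"
  shows "spmf (do {c \<leftarrow> sub_draw (query_seqs G (snd e)) (z (snd e));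
                   seq_suggestion G e (case c of None \<Rightarrow> [] | Some s \<Rightarrow> s)}) a = z_tilde G z e a"
proof -
  let ?S = "query_seqs G (snd e)"
  let ?D = "sub_draw ?S (z (snd e))"
  have S: "finite ?S" "\<And>s. s \<in> ?S \<Longrightarrow> 0 \<le> z (snd e) s" "sum (z (snd e)) ?S \<le> 1"
    using assms finite_query_seqs[OF assms(1)] by (auto simp: LPC_feasible_def)
  let ?g = "\<lambda>c. seq_suggestion G e (case c of None \<Rightarrow> [] | Some s \<Rightarrow> s)"
  have "spmf (?D \<bind> ?g) a = (\<Sum>c\<in>Some ` ?S. pmf (?g c) (Some a) * pmf ?D c)"
    unfolding pmf_bind
  proof (rule integral_measure_pmf_real)
    \<comment> \<open>When nothing is drawn, the empty sequence is processed and no suggestion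
      arises, so only \<open>Some\<close> outcomes contribute.\<close>
    fix c assume "c \<in> set_pmf ?D" "pmf (?g c) (Some a) \<noteq> 0"
    then show "c \<in> Some ` ?S"
      using set_pmf_sub_draw[OF S] by auto
  qed (use S in auto)
  also have "\<dots> = (\<Sum>s\<in>?S. pmf (seq_suggestion G e s) (Some a) * z (snd e) s)"
    by (subst sum.reindex) (auto simp: spmf_sub_draw[OF S])
  also have "\<dots> = z_tilde G z e a"
    unfolding z_tilde_def
    by (intro sum.cong refl, subst pmf_seq_suggestion[OF assms(1)])
       (auto simp: query_seqs_def edges_at_right_def sum_distrib_right)
  finally show ?thesis .
qed

text \<open>By \<open>spmf_suggestion\<close> the numbers \<open>z_tilde G z e a\<close> are masses
  of one probability distribution at distinct outcomes; both bounds follow.\<close>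

lemma z_tilde_subprob:
  assumes "valid_instance G" "LPC_feasible G z" "snd e \<in> right G"
  shows "0 \<le> z_tilde G z e a" "(\<Sum>a\<in>acts G. z_tilde G z e a) \<le> 1"
proof -
  define p where "p = do {c \<leftarrow> sub_draw (query_seqs G (snd e)) (z (snd e));
                   seq_suggestion G e (case c of None \<Rightarrow> [] | Some s \<Rightarrow> s)}"
  have p: "spmf p a = z_tilde G z e a" for a
    unfolding p_def by (rule spmf_suggestion[OF assms])
  show "0 \<le> z_tilde G z e a"
    by (simp add: p[symmetric])
  have "(\<Sum>a\<in>acts G. z_tilde G z e a) = (\<Sum>x\<in>Some ` acts G. pmf p x)"
    by (subst sum.reindex) (auto simp: p)
  also have "\<dots> = measure_pmf.prob p (Some ` acts G)"
    using assms(1) by (subst measure_measure_pmf_finite) (auto simp: valid_instance_def)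
  finally show "(\<Sum>a\<in>acts G. z_tilde G z e a) \<le> 1" by simp
qed

text \<open>Comparing the masses at \<open>Some a\<close> suffices, as \<open>None\<close> takes the
  remainder. Outside \<open>acts G\<close> they vanish because query sequences use only available
  actions.\<close>

lemma suggestion_law:
  assumes "valid_instance G" "LPC_feasible G z" "snd e \<in> right G"
  shows "do {c \<leftarrow> sub_draw (query_seqs G (snd e)) (z (snd e));
             seq_suggestion G e (case c of None \<Rightarrow> [] | Some s \<Rightarrow> s)} =
         sub_draw (acts G) (z_tilde G z e)"
proof (rule spmf_eqI)
  fix a
  have "z_tilde G z e a = 0" if "a \<notin> acts G"
    unfolding z_tilde_def
    using that by (intro sum.neutral ballI) (force simp: query_seqs_def dest: nth_mem)
  then show "spmf (do {c \<leftarrow> sub_draw (query_seqs G (snd e)) (z (snd e));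
             seq_suggestion G e (case c of None \<Rightarrow> [] | Some s \<Rightarrow> s)}) a =
         spmf (sub_draw (acts G) (z_tilde G z e)) a"
    using assms(1)
    by (subst spmf_sub_draw)
       (auto simp: spmf_suggestion[OF assms] z_tilde_subprob[OF assms] valid_instance_def)
qed

text \<open>Every neighbour \<open>v\<close> of \<open>u\<close> contributes exactly one arrival,
  suggested with the law of \<open>suggestion_law\<close>; other right vertices leave the history at
  \<open>u\<close> alone. The freshness assumption ensures that \<open>default_arrivals\<close> does
  not mistake a pending edge for one that has already arrived.\<close>

lemma lazy_vertices_marginal:
  assumes "valid_instance G" "LPC_feasible G z"
    and "distinct vs" "set vs \<subseteq> right G" "\<And>v. v \<in> set vs \<Longrightarrow> (u, v) \<notin> ev_elem ` set (fst st u)"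
  shows "map_pmf (\<lambda>st'. fst st' u) (lazy_vertices G z \<psi> vs st) =
         lazy_run (\<psi> u) (induced_input G z u) (map (Pair u) (filter (\<lambda>v. (u, v) \<in> edges G) vs)) (fst st u)"
  using assms(3-)
proof (induction vs arbitrary: st)
  case (Cons v vs)
  let ?s = "\<lambda>c. case c of None \<Rightarrow> [] | Some s \<Rightarrow> s"
  let ?S = "sub_draw (query_seqs G v) (z v)"
  let ?I = "induced_input G z u"
  let ?run = "lazy_run (\<psi> u) ?I (map (Pair u) (filter (\<lambda>v. (u, v) \<in> edges G) vs))"
  have s: "?s c \<in> query_seqs G v" if "c \<in> set_pmf ?S" for c
    using query_seqs_drawn[OF assms(1,2) _ that] Cons.prems by auto
  have "map_pmf (\<lambda>st'. fst st' u) (lazy_vertices G z \<psi> (v # vs) st) =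
     do {c \<leftarrow> ?S; st' \<leftarrow> lazy_seq G z \<psi> (?s c) st;
         map_pmf (\<lambda>st'. fst st' u) (lazy_vertices G z \<psi> vs (default_arrivals G v st'))}"
    by (simp add: map_bind_pmf)
  also have "\<dots> = do {c \<leftarrow> ?S; st' \<leftarrow> lazy_seq G z \<psi> (?s c) st; ?run (fst (default_arrivals G v st') u)}"
  proof (intro bind_pmf_cong refl Cons.IH)
    fix c st' v'
    assume c: "c \<in> set_pmf ?S" and st': "st' \<in> set_pmf (lazy_seq G z \<psi> (?s c) st)" and v': "v' \<in> set vs"
    \<comment> \<open>Processing \<open>v\<close> records only elements at \<open>v\<close>, so
      later elements stay fresh.\<close>
    have "v' \<noteq> v" "(u, v') \<notin> ev_elem ` set (fst st u)"
      using v' Cons.prems(1) Cons.prems(3)[of v'] by auto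
    moreover have "(u, v') \<notin> fst ` set (?s c)"
      using s[OF c] \<open>v' \<noteq> v\<close> by (auto simp: query_seqs_def edges_at_right_def)
    ultimately have "(u, v') \<notin> ev_elem ` set (fst st' u)"
      using lazy_seq_elems[OF st', of u] by blast
    with \<open>v' \<noteq> v\<close> show "(u, v') \<notin> ev_elem ` set (fst (default_arrivals G v st') u)"
      by (simp add: fst_default_arrivals)
  qed (use Cons.prems in auto)
  also have "\<dots> = lazy_run (\<psi> u) ?I (map (Pair u) (filter (\<lambda>v. (u, v) \<in> edges G) (v # vs))) (fst st u)"
  proof (cases "(u, v) \<in> edges G")
    case True
    let ?f = "\<lambda>st'. fst (default_arrivals G v st') u"
    let ?resolve = "resolve_arrival (\<psi> u) ?I (fst st u) (u, v)"
    have "do {st' \<leftarrow> lazy_seq G z \<psi> (?s c) st; ?run (?f st')} =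
          do {a \<leftarrow> seq_suggestion G (u, v) (?s c); h \<leftarrow> ?resolve a; ?run h}"
      if c: "c \<in> set_pmf ?S" for c
    proof -
      have "map_pmf ?f (lazy_seq G z \<psi> (?s c) st) = seq_suggestion G (u, v) (?s c) \<bind> ?resolve"
        using s[OF c] Cons.prems(3)[of v]
        by (intro lazy_seq_marginal[OF refl True])
           (force simp: query_seqs_def edges_at_right_def)+
      then have "map_pmf ?f (lazy_seq G z \<psi> (?s c) st) \<bind> ?run =
                 (seq_suggestion G (u, v) (?s c) \<bind> ?resolve) \<bind> ?run"
        by (rule arg_cong)
      then show ?thesis
        by (simp only: bind_map_pmf bind_assoc_pmf)
    qed
    then have "do {c \<leftarrow> ?S; st' \<leftarrow> lazy_seq G z \<psi> (?s c) st; ?run (?f st')} =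
               do {c \<leftarrow> ?S; a \<leftarrow> seq_suggestion G (u, v) (?s c); h \<leftarrow> ?resolve a; ?run h}"
      by (intro bind_pmf_cong refl)
    \<comment> \<open>The choice of the sequence and its truncation by coins merge into one draw of
      the suggestion.\<close>
    also have "\<dots> = do {a \<leftarrow> do {c \<leftarrow> ?S; seq_suggestion G (u, v) (?s c)}; h \<leftarrow> ?resolve a; ?run h}"
      by (simp only: bind_assoc_pmf)
    also have "\<dots> = do {a \<leftarrow> sub_draw (acts G) (z_tilde G z (u, v)); h \<leftarrow> ?resolve a; ?run h}"
      using suggestion_law[OF assms(1,2), of "(u, v)"] Cons.prems(2) by simp
    finally show ?thesis
      using True by (simp add: induced_input_def)
  next
    \<comment> \<open>If \<open>(u, v)\<close> is not an edge, no sequence at \<open>v\<close>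
      involves \<open>u\<close>, and \<open>default_arrivals\<close> adds nothing to its
      history.\<close>
    case False
    have "do {st' \<leftarrow> lazy_seq G z \<psi> (?s c) st; ?run (fst (default_arrivals G v st') u)} =
          ?run (fst st u)" if c: "c \<in> set_pmf ?S" for c
    proof -
      have "u \<notin> fst ` fst ` set (?s c)"
        using s[OF c] False by (auto simp: query_seqs_def edges_at_right_def)
      then show ?thesis
        using False by (simp add: lazy_seq_other fst_default_arrivals cong: bind_pmf_cong_simp)
    qed
    then show ?thesis
      using False by (simp cong: bind_pmf_cong_simp)
  qed
  finally show ?case .
qed simp

section \<open>Random arrival orders and the laws of complete runs\<close>

lemma permutations_of_edges_at_left:
  assumes "valid_instance G"
  shows "map_pmf (\<lambda>\<pi>. map (Pair u) (filter (\<lambda>v. (u, v) \<in> edges G) \<pi>))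
           (pmf_of_set (permutations_of_set (right G))) =
         pmf_of_set (permutations_of_set (edges_at_left G u))"
proof -
  let ?P = "\<lambda>v. (u, v) \<in> edges G"
  let ?R = "{v \<in> right G. ?P v}"
  have fin: "finite (right G)" using assms by (simp add: valid_instance_def)
  have E: "edges_at_left G u = Pair u ` ?R"
    using assms by (force simp: edges_at_left_def valid_instance_def)
  \<comment> \<open>\<open>filter\<close> is the first component of \<open>partition\<close>, whose
    two parts are independent uniformly random orders.\<close>
  have "map_pmf (filter ?P) (pmf_of_set (permutations_of_set (right G))) =
        map_pmf fst (map_pmf (partition ?P) (pmf_of_set (permutations_of_set (right G))))"
    by (simp add: pmf.map_comp o_def)
  also have "\<dots> = pmf_of_set (permutations_of_set ?R)"
    using fin by (simp add: partition_random_permutations map_fst_pair_pmf)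
  finally have filter: "map_pmf (filter ?P) (pmf_of_set (permutations_of_set (right G))) =
    pmf_of_set (permutations_of_set ?R)" .
  have "map_pmf (\<lambda>\<pi>. map (Pair u) (filter ?P \<pi>)) (pmf_of_set (permutations_of_set (right G))) =
        map_pmf (map (Pair u)) (map_pmf (filter ?P) (pmf_of_set (permutations_of_set (right G))))"
    by (simp add: pmf.map_comp o_def)
  also have "\<dots> = pmf_of_set (map (Pair u) ` permutations_of_set ?R)"
    unfolding filter using fin by (intro map_pmf_of_set_inj) (auto intro!: inj_onI dest: map_injective)
  also have "map (Pair u) ` permutations_of_set ?R = permutations_of_set (edges_at_left G u)"
    unfolding E by (intro permutations_of_set_image_inj[symmetric]) (auto intro: inj_onI)
  finally show ?thesis .
qed

definition lazy_policy ::
  "('u, 'v, 'a) qc_instance \<Rightarrow> ('u, 'v, 'a) lp_var \<Rightarrow> ('u \<Rightarrow> ('u \<times> 'v, 'a) prcrs) \<Rightarrow>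
   ('u, 'v, 'a) policy_state pmf"
where
  "lazy_policy G z \<psi> =
     do {
       \<pi> \<leftarrow> pmf_of_set (permutations_of_set (right G));
       lazy_vertices G z \<psi> \<pi> (\<lambda>_. [], {})
     }"

text \<open>Only the history is kept: selectability will be used in an unconditional form that does
  not involve the suggestion vector.\<close>

definition lazy_experiment :: "('i, 'a) prcrs \<Rightarrow> ('i, 'a) prcrs_input \<Rightarrow> ('i, 'a) event list pmf" where
  "lazy_experiment \<psi> I =
     do {
       \<sigma> \<leftarrow> pmf_of_set (permutations_of_set (in_elems I));
       lazy_run \<psi> I \<sigma> []
     }"

text \<open>The order is independent of the coins, so it can be drawn first and the coins deferred
  for each order separately.\<close>

lemma rounding_policy_eq_lazy:
  assumes "valid_instance G" "LPC_feasible G z"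
  shows "rounding_policy G z \<psi> = map_pmf snd (lazy_policy G z \<psi>)"
proof -
  let ?perms = "pmf_of_set (permutations_of_set (right G))"
  have fin: "finite (right G)" using assms by (simp add: valid_instance_def)
  have "rounding_policy G z \<psi> =
    map_pmf snd (do {Q \<leftarrow> coin_table G; Q' \<leftarrow> coin_table G; \<pi> \<leftarrow> ?perms;
                     process_vertices G z \<psi> Q Q' \<pi> (\<lambda>_. [], {})})"
    by (simp add: rounding_policy_def map_bind_pmf case_prod_unfold map_pmf_def[of snd])
  also have "do {Q \<leftarrow> coin_table G; Q' \<leftarrow> coin_table G; \<pi> \<leftarrow> ?perms;
                     process_vertices G z \<psi> Q Q' \<pi> (\<lambda>_. [], {})} =
             do {\<pi> \<leftarrow> ?perms; Q \<leftarrow> coin_table G; Q' \<leftarrow> coin_table G;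
                     process_vertices G z \<psi> Q Q' \<pi> (\<lambda>_. [], {})}"
    by (simp add: bind_commute_pmf[of "coin_table G" ?perms])
  also have "\<dots> = lazy_policy G z \<psi>"
    unfolding lazy_policy_def
    using fin by (intro bind_pmf_cong refl process_vertices_deferred[OF assms])
       (auto dest: permutations_of_setD)
  finally show ?thesis .
qed

text \<open>This transfers guarantees for \<open>\<psi> u\<close> to the policy. Histories of
  different schemes may be correlated, but linearity of expectation uses only one marginal at a
  time.\<close>

lemma lazy_policy_history:
  assumes "valid_instance G" "LPC_feasible G z"
  shows "map_pmf (\<lambda>st. fst st u) (lazy_policy G z \<psi>) = lazy_experiment (\<psi> u) (induced_input G z u)"
proof -
  let ?perms = "pmf_of_set (permutations_of_set (right G))"
  let ?ord = "\<lambda>\<pi>. map (Pair u) (filter (\<lambda>v. (u, v) \<in> edges G) \<pi>)"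
  have fin: "finite (right G)" using assms by (simp add: valid_instance_def)
  have "map_pmf (\<lambda>st. fst st u) (lazy_policy G z \<psi>) =
    do {\<pi> \<leftarrow> ?perms; map_pmf (\<lambda>st. fst st u) (lazy_vertices G z \<psi> \<pi> (\<lambda>_. [], {}))}"
    by (simp add: lazy_policy_def map_bind_pmf)
  also have "\<dots> = do {\<pi> \<leftarrow> ?perms; lazy_run (\<psi> u) (induced_input G z u) (?ord \<pi>) []}"
  proof (intro bind_pmf_cong refl)
    fix \<pi> assume "\<pi> \<in> set_pmf ?perms"
    then have "distinct \<pi>" "set \<pi> = right G"
      using fin by (auto dest: permutations_of_setD)
    then show "map_pmf (\<lambda>st. fst st u) (lazy_vertices G z \<psi> \<pi> (\<lambda>_. [], {})) =
               lazy_run (\<psi> u) (induced_input G z u) (?ord \<pi>) []"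
      using lazy_vertices_marginal[OF assms, of \<pi> u "(\<lambda>_. [], {})"] by simp
  qed
  also have "\<dots> = do {\<sigma> \<leftarrow> map_pmf ?ord ?perms; lazy_run (\<psi> u) (induced_input G z u) \<sigma> []}"
    by (simp add: bind_map_pmf)
  also have "\<dots> = lazy_experiment (\<psi> u) (induced_input G z u)"
    unfolding permutations_of_edges_at_left[OF assms(1)]
    by (simp add: lazy_experiment_def induced_input_def)
  finally show ?thesis .
qed

lemma prcrs_experiment_history:
  assumes "valid_input I"
  shows "map_pmf snd (prcrs_experiment \<psi> I) = lazy_experiment \<psi> I"
proof -
  let ?perms = "pmf_of_set (permutations_of_set (in_elems I))"
  let ?PP = "Pi_pmf (in_elems I \<times> in_actions I) False (\<lambda>(i, a). bernoulli_pmf (in_state_prob I i a))"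
  let ?PX = "Pi_pmf (in_elems I) None (\<lambda>i. sub_draw (in_actions I) (in_sugg_prob I i))"
  have "map_pmf snd (prcrs_experiment \<psi> I) =
        do {P \<leftarrow> ?PP; X \<leftarrow> ?PX; \<sigma> \<leftarrow> ?perms; prcrs_run \<psi> I P X \<sigma> []}"
    by (simp add: prcrs_experiment_def map_bind_pmf bind_return_pmf')
  also have "\<dots> = do {\<sigma> \<leftarrow> ?perms; P \<leftarrow> ?PP; X \<leftarrow> ?PX; prcrs_run \<psi> I P X \<sigma> []}"
    by (simp add: bind_commute_pmf[of _ ?perms])
  also have "\<dots> = lazy_experiment \<psi> I"
    unfolding lazy_experiment_def
    using assms by (intro bind_pmf_cong refl prcrs_run_deferred)
       (auto dest: permutations_of_setD simp: valid_input_def)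
  finally show ?thesis .
qed

lemma prcrs_experiment_suggestions:
  "map_pmf fst (prcrs_experiment \<psi> I) =
     Pi_pmf (in_elems I) None (\<lambda>i. sub_draw (in_actions I) (in_sugg_prob I i))"
  by (simp add: prcrs_experiment_def map_bind_pmf bind_return_pmf')

text \<open>Multiplying the conditional guarantee by the probability of the suggestion turns it into
  a bound on the law of the history alone.\<close>

lemma selectable_query_prob:
  assumes "valid_input I" "selectable \<psi> (in_patience I) \<alpha>"
    and "i \<in> in_elems I" "a \<in> in_actions I"
  shows "\<alpha> * in_sugg_prob I i a \<le>
         measure_pmf.prob (lazy_experiment \<psi> I) {h. \<exists>b. Query i a b \<in> set h}"
proof (cases "in_sugg_prob I i a > 0")
  \<comment> \<open>Selectability is silent about suggestions of probability 0, but then the left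
    side is 0.\<close>
  case False
  then have "in_sugg_prob I i a = 0"
    using assms by (force simp: valid_input_def)
  then show ?thesis by simp
next
  case True
  let ?M = "prcrs_experiment \<psi> I"
  have "measure_pmf.prob ?M {\<omega>. fst \<omega> i = Some a} =
        measure_pmf.prob (map_pmf (\<lambda>X. X i) (map_pmf fst ?M)) {Some a}"
    by (simp add: vimage_def)
  also have "\<dots> = in_sugg_prob I i a"
    unfolding prcrs_experiment_suggestions using assms
    by (subst Pi_pmf_component) (auto simp: valid_input_def measure_pmf_single spmf_sub_draw)
  finally have B: "measure_pmf.prob ?M {\<omega>. fst \<omega> i = Some a} = in_sugg_prob I i a" .
  have "\<alpha> \<le> \<P>(\<omega> in measure_pmf ?M. (\<exists>b. Query i a b \<in> set (snd \<omega>)) \<bar> fst \<omega> i = Some a)"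
    using assms True by (auto simp: selectable_def selectable_on_def)
  then have "\<alpha> \<le> measure_pmf.prob ?M {\<omega>. (\<exists>b. Query i a b \<in> set (snd \<omega>)) \<and> fst \<omega> i = Some a}
                  / in_sugg_prob I i a"
    by (simp add: cond_prob_def B)
  then have "\<alpha> * in_sugg_prob I i a \<le>
      measure_pmf.prob ?M {\<omega>. (\<exists>b. Query i a b \<in> set (snd \<omega>)) \<and> fst \<omega> i = Some a}"
    using True by (simp add: field_simps)
  \<comment> \<open>Dropping the suggestion event can only enlarge the event.\<close>
  also have "\<dots> \<le> measure_pmf.prob ?M {\<omega>. \<exists>b. Query i a b \<in> set (snd \<omega>)}"
    by (intro measure_pmf.finite_measure_mono) auto
  also have "\<dots> = measure_pmf.prob (map_pmf snd ?M) {h. \<exists>b. Query i a b \<in> set h}"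
    by (simp add: vimage_def)
  finally show ?thesis
    by (simp add: prcrs_experiment_history[OF assms(1)])
qed

section \<open>Queries and successes\<close>

lemma lazy_run_other:
  assumes "i \<notin> set \<sigma>" "h' \<in> set_pmf (lazy_run \<psi> I \<sigma> h)"
  shows "Query i a b \<in> set h' \<longleftrightarrow> Query i a b \<in> set h"
  using assms
proof (induction \<sigma> arbitrary: h)
  case (Cons j \<sigma>)
  from Cons.prems obtain ev where "h' \<in> set_pmf (lazy_run \<psi> I \<sigma> (h @ [ev]))" "ev_elem ev = j"
    by (auto simp: resolve_arrival_def)
  then show ?case
    using Cons.IH[of "h @ [ev]"] Cons.prems(1) by (cases ev) auto
qed simp

text \<open>The state coin is flipped independently of the decision and \<open>i\<close> arrives at
  most once, so success is the query event thinned by an independent coin. An equality of laws,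
  rather than of probabilities, passes directly through the draws of the recursion.\<close>

lemma lazy_run_success:
  assumes "distinct \<sigma>" "i \<notin> ev_elem ` set h"
  shows "map_pmf (\<lambda>h'. Query i a True \<in> set h') (lazy_run \<psi> I \<sigma> h) =
         do {
           d \<leftarrow> map_pmf (\<lambda>h'. \<exists>b. Query i a b \<in> set h') (lazy_run \<psi> I \<sigma> h);
           c \<leftarrow> bernoulli_pmf (in_state_prob I i a);
           return_pmf (d \<and> c)
         }"
  using assms
proof (induction \<sigma> arbitrary: h)
  case Nil
  then have "Query i a b \<notin> set h" for b by force
  then show ?case by (simp add: bind_return_pmf)
next
  case (Cons j \<sigma>)
  let ?S = "sub_draw (in_actions I) (in_sugg_prob I j)"
  let ?D = "scheme_decision \<psi> I h j"
  let ?h = "\<lambda>s b c. h @ [if b then Query j (the s) c else Pass j s]"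
  let ?T = "\<lambda>h'. Query i a True \<in> set h'" and ?Q = "\<lambda>h'. \<exists>b. Query i a b \<in> set h'"
  let ?thin = "\<lambda>d. do {c \<leftarrow> bernoulli_pmf (in_state_prob I i a); return_pmf (d \<and> c)}"
  have run: "map_pmf f (lazy_run \<psi> I (j # \<sigma>) h) =
      do {s \<leftarrow> ?S; b \<leftarrow> ?D s; c \<leftarrow> bernoulli_pmf (in_state_prob I j (the s));
          map_pmf f (lazy_run \<psi> I \<sigma> (?h s b c))}" for f :: "_ \<Rightarrow> bool"
    by (simp add: resolve_arrival_def map_bind_pmf bind_assoc_pmf bind_return_pmf)
  have "do {c \<leftarrow> bernoulli_pmf (in_state_prob I j (the s)); map_pmf ?T (lazy_run \<psi> I \<sigma> (?h s b c))} =
        do {c \<leftarrow> bernoulli_pmf (in_state_prob I j (the s));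
            map_pmf ?Q (lazy_run \<psi> I \<sigma> (?h s b c)) \<bind> ?thin}" for s b
  proof (cases "j = i")
    case False
    have "map_pmf ?T (lazy_run \<psi> I \<sigma> (?h s b c)) = map_pmf ?Q (lazy_run \<psi> I \<sigma> (?h s b c)) \<bind> ?thin"
      for c
      by (rule Cons.IH) (use Cons.prems False in auto)
    then show ?thesis by simp
  next
    case True
    have h: "Query i a' b' \<notin> set h" for a' b' using Cons.prems(2) by force
    \<comment> \<open>Later arrivals concern other elements, so the event just appended settles both
      predicates.\<close>
    have after: "Query i a b' \<in> set h' \<longleftrightarrow> b \<and> the s = a \<and> c = b'"
      if "h' \<in> set_pmf (lazy_run \<psi> I \<sigma> (?h s b c))" for h' b' c
      using lazy_run_other[OF _ that, of i a b'] Cons.prems(1) True h[of a b'] by auto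
    have T: "map_pmf ?T (lazy_run \<psi> I \<sigma> (?h s b c)) = return_pmf (b \<and> the s = a \<and> c)" for c
      by (rule map_pmf_constant) (simp add: after)
    have Q: "map_pmf ?Q (lazy_run \<psi> I \<sigma> (?h s b c)) = return_pmf (b \<and> the s = a)" for c
      by (rule map_pmf_constant) (simp add: after)
    \<comment> \<open>For \<open>the s = a\<close> the state coin has the bias of the thinning coin.
      Otherwise the biases may differ, but both sides are surely \<open>False\<close>.\<close>
    show ?thesis
      using True by (cases "the s = a") (auto simp: T Q bind_return_pmf)
  qed
  then show ?case
    by (simp only: run bind_assoc_pmf)
qed

lemma lazy_experiment_success:
  assumes "finite (in_elems I)" "in_state_prob I i a \<in> {0..1}"
  shows "measure_pmf.prob (lazy_experiment \<psi> I) {h. Query i a True \<in> set h} =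
         in_state_prob I i a * measure_pmf.prob (lazy_experiment \<psi> I) {h. \<exists>b. Query i a b \<in> set h}"
proof -
  let ?L = "lazy_experiment \<psi> I"
  let ?T = "\<lambda>h'. Query i a True \<in> set h'" and ?Q = "\<lambda>h'. \<exists>b. Query i a b \<in> set h'"
  have prob: "measure_pmf.prob p {h. f h} = pmf (map_pmf f p) True" for p :: "'x pmf" and f
    by (simp add: pmf_map vimage_def)
  define R where "R = map_pmf ?Q ?L"
  have "map_pmf ?T ?L =
     do {d \<leftarrow> R; c \<leftarrow> bernoulli_pmf (in_state_prob I i a); return_pmf (d \<and> c)}"
    unfolding R_def lazy_experiment_def map_bind_pmf bind_assoc_pmf
    using assms(1) by (intro bind_pmf_cong refl lazy_run_success) (auto dest: permutations_of_setD)
  \<comment> \<open>With the coin outermost, the outcome \<open>True\<close> leaves \<open>R\<close>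
    and \<open>False\<close> contributes nothing.\<close>
  also have "\<dots> = do {c \<leftarrow> bernoulli_pmf (in_state_prob I i a);
                      d \<leftarrow> R; return_pmf (d \<and> c)}"
    by (rule bind_commute_pmf)
  finally have "pmf (map_pmf ?T ?L) True = in_state_prob I i a * pmf R True"
    using assms(2) by (simp add: pmf_bind bind_return_pmf' measure_pmf_single)
  then show ?thesis by (simp only: prob R_def)
qed

text \<open>An insertion into the matching and a \<open>Query\<close> event with state
  \<open>True\<close> always occur together. Membership of an edge in the matching can thus be read
  off the history of its left endpoint.\<close>

lemma lazy_seq_matching:
  assumes "st' \<in> set_pmf (lazy_seq G z \<psi> s st)"
    and "\<And>e a. (e, a) \<in> snd st \<longleftrightarrow> Query e a True \<in> set (fst st (fst e))"
  shows "(e, a) \<in> snd st' \<longleftrightarrow> Query e a True \<in> set (fst st' (fst e))"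
    and "snd st' \<subseteq> snd st \<union> set s"
proof -
  have "(\<forall>e a. (e, a) \<in> snd st' \<longleftrightarrow> Query e a True \<in> set (fst st' (fst e))) \<and> snd st' \<subseteq> snd st \<union> set s"
    using assms
  proof (induction s arbitrary: st)
    case (Cons x s)
    obtain e a where x: "x = (e, a)" by (cases x)
    from Cons.prems(1) obtain b c where
      st': "st' = after_query (e, a) b c st \<or> st' \<in> set_pmf (lazy_seq G z \<psi> s (after_query (e, a) b c st))"
      by (auto simp: x split: if_splits)
    let ?st = "after_query (e, a) b c st"
    have 1: "(e', a') \<in> snd ?st \<longleftrightarrow> Query e' a' True \<in> set (fst ?st (fst e'))" for e' a'
      using Cons.prems(2)[of e' a'] by (auto simp: fst_after_query snd_after_query)
    have 2: "snd ?st \<subseteq> insert (e, a) (snd st)"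
      by (auto simp: snd_after_query)
    show ?case
      using st'
    proof
      assume "st' = ?st"
      then show ?thesis using 1 2 by (auto simp: x)
    next
      assume "st' \<in> set_pmf (lazy_seq G z \<psi> s ?st)"
      from Cons.IH[OF this 1] 2 show ?thesis by (auto simp: x)
    qed
  qed simp
  then show "(e, a) \<in> snd st' \<longleftrightarrow> Query e a True \<in> set (fst st' (fst e))" "snd st' \<subseteq> snd st \<union> set s"
    by blast+
qed

text \<open>Default arrivals are passes and preserve the correspondence; drawn sequences use only
  edges and actions of \<open>G\<close>, which gives the inclusion.\<close>

lemma lazy_vertices_matching:
  assumes "valid_instance G" "LPC_feasible G z" "set vs \<subseteq> right G"
    and "st' \<in> set_pmf (lazy_vertices G z \<psi> vs st)"
    and "\<And>e a. (e, a) \<in> snd st \<longleftrightarrow> Query e a True \<in> set (fst st (fst e))"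
    and "snd st \<subseteq> edges G \<times> acts G"
  shows "(\<forall>e a. (e, a) \<in> snd st' \<longleftrightarrow> Query e a True \<in> set (fst st' (fst e))) \<and>
         snd st' \<subseteq> edges G \<times> acts G"
  using assms(3-)
proof (induction vs arbitrary: st)
  case (Cons v vs)
  from Cons.prems(2) obtain c st1 where
    c: "c \<in> set_pmf (sub_draw (query_seqs G v) (z v))" and
    st1: "st1 \<in> set_pmf (lazy_seq G z \<psi> (case c of None \<Rightarrow> [] | Some s \<Rightarrow> s) st)" and
    st': "st' \<in> set_pmf (lazy_vertices G z \<psi> vs (default_arrivals G v st1))"
    by auto
  have sub: "set (case c of None \<Rightarrow> [] | Some s \<Rightarrow> s) \<subseteq> edges G \<times> acts G"
    using query_seqs_drawn[OF assms(1,2) _ c] Cons.prems(1)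
    by (auto simp: query_seqs_def edges_at_right_def)
  note M = lazy_seq_matching[OF st1 Cons.prems(3)]
  show ?case
  proof (rule Cons.IH[OF _ st'])
    show "set vs \<subseteq> right G" using Cons.prems(1) by simp
    show "(e, a) \<in> snd (default_arrivals G v st1) \<longleftrightarrow>
          Query e a True \<in> set (fst (default_arrivals G v st1) (fst e))" for e a
      using M(1)[of e a] by (auto simp: fst_default_arrivals)
    show "snd (default_arrivals G v st1) \<subseteq> edges G \<times> acts G"
      using M(2) sub Cons.prems(4) by auto
  qed
qed simp

section \<open>Linear programming bounds\<close>

text \<open>Double counting: after exchanging the sums, positions are grouped by the pair
  \<open>s ! i\<close> found there. The weight \<open>f\<close> is left open because the two
  constraints at a left vertex and the objective of (LP-C) need different weights.\<close>

lemma sum_z_tilde: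
  assumes "finite D" "\<And>x. x \<in> D \<Longrightarrow> snd (fst x) = v"
  shows "(\<Sum>(e, a)\<in>D. f e a * z_tilde G z e a) =
         (\<Sum>s\<in>query_seqs G v. \<Sum>i | i < length s \<and> s ! i \<in> D.
            f (fst (s ! i)) (snd (s ! i)) * reach_prob G s i * z v s)"
proof -
  let ?t = "\<lambda>s i. f (fst (s ! i)) (snd (s ! i)) * reach_prob G s i * z v s"
  have "(\<Sum>(e, a)\<in>D. f e a * z_tilde G z e a) =
        (\<Sum>x\<in>D. \<Sum>s\<in>query_seqs G v. \<Sum>i | i < length s \<and> s ! i = x. ?t s i)"
    using assms(2) by (intro sum.cong) (auto simp: z_tilde_def sum_distrib_left mult.assoc intro!: sum.cong)
  also have "\<dots> = (\<Sum>s\<in>query_seqs G v. \<Sum>x\<in>D. \<Sum>i | i < length s \<and> s ! i = x. ?t s i)"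
    by (rule sum.swap)
  also have "\<dots> = (\<Sum>s\<in>query_seqs G v. \<Sum>i | i < length s \<and> s ! i \<in> D. ?t s i)"
  proof (rule sum.cong[OF refl])
    fix s
    have "(\<Sum>x\<in>D. \<Sum>i | i < length s \<and> s ! i = x. ?t s i) =
          (\<Sum>x\<in>D. \<Sum>i | i \<in> {i. i < length s \<and> s ! i \<in> D} \<and> s ! i = x. ?t s i)"
      by (intro sum.cong) auto
    also have "\<dots> = (\<Sum>i | i < length s \<and> s ! i \<in> D. ?t s i)"
      using assms(1) by (intro sum.group) auto
    finally show "(\<Sum>x\<in>D. \<Sum>i | i < length s \<and> s ! i = x. ?t s i) =
      (\<Sum>i | i < length s \<and> s ! i \<in> D. ?t s i)" .
  qed
  finally show ?thesis .
qed

lemma sum_z_tilde_left: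
  assumes "valid_instance G"
  shows "(\<Sum>e\<in>edges_at_left G u. \<Sum>a\<in>acts G. f e a * z_tilde G z e a) =
         (\<Sum>v\<in>right G. \<Sum>s\<in>query_seqs G v. \<Sum>i | i < length s \<and> fst (s ! i) = (u, v).
            f (u, v) (snd (s ! i)) * reach_prob G s i * z v s)"
proof -
  let ?R = "{v \<in> right G. (u, v) \<in> edges G}"
  let ?T = "\<lambda>v. \<Sum>s\<in>query_seqs G v. \<Sum>i | i < length s \<and> fst (s ! i) = (u, v).
            f (u, v) (snd (s ! i)) * reach_prob G s i * z v s"
  have fin: "finite (right G)" "finite (acts G)" using assms by (auto simp: valid_instance_def)
  have mem: "s ! i \<in> edges_at_right G v \<times> acts G" if "s \<in> query_seqs G v" "i < length s" for s i v
    using that by (auto simp: query_seqs_def dest: nth_mem)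
  have E: "edges_at_left G u = Pair u ` ?R"
    using assms by (force simp: edges_at_left_def valid_instance_def)
  have "(\<Sum>e\<in>edges_at_left G u. \<Sum>a\<in>acts G. f e a * z_tilde G z e a) =
        (\<Sum>v\<in>?R. \<Sum>a\<in>acts G. f (u, v) a * z_tilde G z (u, v) a)"
    unfolding E by (subst sum.reindex) (auto intro: inj_onI)
  also have "\<dots> = (\<Sum>v\<in>?R. ?T v)"
  proof (rule sum.cong[OF refl])
    fix v assume "v \<in> ?R"
    have "(\<Sum>a\<in>acts G. f (u, v) a * z_tilde G z (u, v) a) =
          (\<Sum>(e, a)\<in>{(u, v)} \<times> acts G. f e a * z_tilde G z e a)"
      by (simp add: sum.cartesian_product[symmetric])
    also have "\<dots> = (\<Sum>s\<in>query_seqs G v. \<Sum>i | i < length s \<and> s ! i \<in> {(u, v)} \<times> acts G.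
            f (fst (s ! i)) (snd (s ! i)) * reach_prob G s i * z v s)"
      using fin by (intro sum_z_tilde) auto
    also have "\<dots> = ?T v"
      using mem by (intro sum.cong) (fastforce simp: mem_Times_iff)+
    finally show "(\<Sum>a\<in>acts G. f (u, v) a * z_tilde G z (u, v) a) = ?T v" .
  qed
  also have "\<dots> = (\<Sum>v\<in>right G. ?T v)"
  proof (rule sum.mono_neutral_left)
    \<comment> \<open>Right vertices not adjacent to \<open>u\<close> contribute nothing, since
      sequences contain only edges of \<open>G\<close>.\<close>
    show "\<forall>v\<in>right G - ?R. ?T v = 0"
      using mem by (auto intro!: sum.neutral simp: mem_Times_iff edges_at_right_def) metis
  qed (use fin in auto)
  finally show ?thesis .
qed

text \<open>With reward times success probability as weight, the positions of one sequence sum to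
  its \<open>val\<close>; grouping the edges by right endpoint gives the objective of
  (LP-C).\<close>

lemma sum_z_tilde_right:
  assumes "valid_instance G"
  shows "(\<Sum>(e, a)\<in>edges G \<times> acts G. reward G e a * qprob G e a * z_tilde G z e a) =
         (\<Sum>v\<in>right G. \<Sum>s\<in>query_seqs G v. val G s * z v s)"
proof -
  let ?g = "\<lambda>(e, a). reward G e a * qprob G e a * z_tilde G z e a"
  let ?D = "\<lambda>v. {x \<in> edges G \<times> acts G. snd (fst x) = v}"
  have "sum ?g (edges G \<times> acts G) = (\<Sum>v\<in>right G. sum ?g (?D v))"
    using assms finite_edges[OF assms]
    by (intro sum.group[symmetric]) (auto simp: valid_instance_def)
  also have "\<dots> = (\<Sum>v\<in>right G. \<Sum>s\<in>query_seqs G v. val G s * z v s)"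
  proof (rule sum.cong[OF refl])
    fix v
    have "sum ?g (?D v) = (\<Sum>s\<in>query_seqs G v. \<Sum>i | i < length s \<and> s ! i \<in> ?D v.
        reward G (fst (s ! i)) (snd (s ! i)) * qprob G (fst (s ! i)) (snd (s ! i)) * reach_prob G s i * z v s)"
      using finite_edges[OF assms] by (intro sum_z_tilde) auto
    also have "\<dots> = (\<Sum>s\<in>query_seqs G v. val G s * z v s)"
    proof (rule sum.cong[OF refl])
      fix s assume "s \<in> query_seqs G v"
      then have "s ! i \<in> ?D v" if "i < length s" for i
        using nth_mem[OF that] by (auto simp: query_seqs_def edges_at_right_def)
      then have "{i. i < length s \<and> s ! i \<in> ?D v} = {..<length s}"
        by blast
      then show "(\<Sum>i | i < length s \<and> s ! i \<in> ?D v. reward G (fst (s ! i)) (snd (s ! i)) *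
          qprob G (fst (s ! i)) (snd (s ! i)) * reach_prob G s i * z v s) = val G s * z v s"
        by (simp add: val_def sum_distrib_right)
    qed
    finally show "sum ?g (?D v) = (\<Sum>s\<in>query_seqs G v. val G s * z v s)" .
  qed
  finally show ?thesis .
qed

text \<open>The weights 1 and \<open>qprob G\<close> in \<open>sum_z_tilde_left\<close> turn the two
  constraints of (LP-C) at \<open>u\<close> into the patience and success bounds. The bound for a
  single element reflects that an edge receives at most one suggestion.\<close>

lemma valid_induced_input:
  assumes "valid_instance G" "LPC_feasible G z" "u \<in> left G"
  shows "valid_input (induced_input G z u)"
proof -
  have fin: "finite (edges_at_left G u)" "finite (acts G)"
    using assms(1) finite_edges[OF assms(1)] by (auto simp: edges_at_left_def valid_instance_def)
  have e: "e \<in> edges G" "snd e \<in> right G" if "e \<in> edges_at_left G u" for e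
    using that assms(1) by (auto simp: edges_at_left_def valid_instance_def)
  note zt = z_tilde_subprob[OF assms(1,2)]
  have le1: "z_tilde G z x a \<le> 1" if "x \<in> edges_at_left G u" "a \<in> acts G" for x a
  proof -
    have "z_tilde G z x a \<le> (\<Sum>a\<in>acts G. z_tilde G z x a)"
      using that fin zt e by (intro member_le_sum) auto
    then show ?thesis using zt(2)[OF e(2)[OF that(1)]] by simp
  qed
  have q: "qprob G x a \<in> {0..1}" if "x \<in> edges_at_left G u" "a \<in> acts G" for x a
    using assms(1,3) e[OF that(1)] that(2) by (auto simp: valid_instance_def)
  have "ereal (\<Sum>e\<in>edges_at_left G u. \<Sum>a\<in>acts G. z_tilde G z e a) \<le> ereal_of_enat (lpat G u)"
    using sum_z_tilde_left[OF assms(1), where f = "\<lambda>_ _. 1" and u = u and z = z] assms(2,3)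
    by (simp add: LPC_feasible_def)
  moreover have "(\<Sum>e\<in>edges_at_left G u. \<Sum>a\<in>acts G. qprob G e a * z_tilde G z e a) \<le> 1"
    using sum_z_tilde_left[OF assms(1), where f = "qprob G" and u = u and z = z] assms(2,3)
    by (simp add: LPC_feasible_def)
  ultimately show ?thesis
    unfolding valid_input_def induced_input_def
    using fin q zt e le1 assms(1,3) by (auto simp: valid_instance_def)
qed

section \<open>Expected reward by linearity\<close>

theorem mainTheorem4:
  fixes G :: "('u, 'v, 'a) qc_instance"
    and z :: "('u, 'v, 'a) lp_var"
    and \<psi> :: "'u \<Rightarrow> ('u \<times> 'v, 'a) prcrs"
    and \<alpha> :: real
  assumes "\<alpha> \<ge> 0"
    and "valid_instance G"
    and "LPC_feasible G z"
    and "\<And>u. u \<in> left G \<Longrightarrow> selectable (\<psi> u) (lpat G u) \<alpha>"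
  shows "expected_reward G (rounding_policy G z \<psi>)
           \<ge> \<alpha> * (\<Sum>v\<in>right G. \<Sum>s\<in>query_seqs G v. val G s * z v s)"
proof -
  let ?L = "lazy_policy G z \<psi>"
  let ?EA = "edges G \<times> acts G"
  have fin: "finite ?EA" by (rule finite_edges[OF assms(2)])
  have L: "(\<forall>e a. (e, a) \<in> snd st \<longleftrightarrow> Query e a True \<in> set (fst st (fst e))) \<and> snd st \<subseteq> ?EA"
    if st: "st \<in> set_pmf ?L" for st
  proof -
    have "finite (right G)" using assms(2) by (simp add: valid_instance_def)
    with st obtain \<pi> where "set \<pi> = right G" "st \<in> set_pmf (lazy_vertices G z \<psi> \<pi> (\<lambda>_. [], {}))"
      by (auto simp: lazy_policy_def dest: permutations_of_setD)
    then show ?thesis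
      using lazy_vertices_matching[OF assms(2,3), of \<pi> st \<psi> "(\<lambda>_. [], {})"] by simp
  qed
  \<comment> \<open>Selectability bounds the query probability, the independent state coin
    contributes the factor \<open>qprob G e a\<close>, and \<open>lazy_policy_history\<close>
    carries the result over to the policy.\<close>
  have matched: "\<alpha> * (qprob G e a * z_tilde G z e a) \<le> measure_pmf.prob ?L {st. (e, a) \<in> snd st}"
    if ea: "e \<in> edges G" "a \<in> acts G" for e a
  proof -
    let ?u = "fst e"
    let ?I = "induced_input G z ?u"
    have u: "?u \<in> left G" and q: "qprob G e a \<in> {0..1}"
      using assms(2) ea by (auto simp: valid_instance_def)
    have I: "in_elems ?I = edges_at_left G ?u" "in_actions ?I = acts G" "in_patience ?I = lpat G ?u"
      "in_state_prob ?I = qprob G" "in_sugg_prob ?I = z_tilde G z"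
      by (simp_all add: induced_input_def)
    have valid: "valid_input ?I" by (rule valid_induced_input[OF assms(2,3) u])
    have "\<alpha> * z_tilde G z e a \<le>
          measure_pmf.prob (lazy_experiment (\<psi> ?u) ?I) {h. \<exists>b. Query e a b \<in> set h}"
      using selectable_query_prob[OF valid, of "\<psi> ?u" \<alpha> e a] assms(4)[OF u] ea
      by (simp add: I edges_at_left_def)
    then have "qprob G e a * (\<alpha> * z_tilde G z e a) \<le>
          qprob G e a * measure_pmf.prob (lazy_experiment (\<psi> ?u) ?I) {h. \<exists>b. Query e a b \<in> set h}"
      using q by (intro mult_left_mono) auto
    also have "\<dots> = measure_pmf.prob (lazy_experiment (\<psi> ?u) ?I) {h. Query e a True \<in> set h}"
      using lazy_experiment_success[of ?I e a "\<psi> ?u"] valid q by (simp add: I valid_input_def)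
    also have "\<dots> = measure_pmf.prob ?L {st. Query e a True \<in> set (fst st ?u)}"
      by (simp add: lazy_policy_history[OF assms(2,3), symmetric] vimage_def)
    also have "\<dots> = measure_pmf.prob ?L {st. (e, a) \<in> snd st}"
    proof (intro measure_pmf.finite_measure_eq_AE AE_pmfI)
      fix st assume "st \<in> set_pmf ?L"
      then have "(e, a) \<in> snd st \<longleftrightarrow> Query e a True \<in> set (fst st ?u)"
        using L by blast
      then show "st \<in> {st. Query e a True \<in> set (fst st ?u)} \<longleftrightarrow> st \<in> {st. (e, a) \<in> snd st}"
        by simp
    qed auto
    finally show ?thesis by (simp add: mult_ac)
  qed
  have "\<alpha> * (\<Sum>v\<in>right G. \<Sum>s\<in>query_seqs G v. val G s * z v s) =
        (\<Sum>(e, a)\<in>?EA. reward G e a * (\<alpha> * (qprob G e a * z_tilde G z e a)))"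
    by (simp add: sum_z_tilde_right[OF assms(2), symmetric] sum_distrib_left case_prod_unfold mult_ac)
  \<comment> \<open>Rewards are nonnegative, so the bounds for single pairs can be weighted and
    added.\<close>
  also have "\<dots> \<le> (\<Sum>(e, a)\<in>?EA. reward G e a * measure_pmf.prob ?L {st. (e, a) \<in> snd st})"
    using matched assms(2) by (intro sum_mono) (auto intro!: mult_left_mono simp: valid_instance_def)
  also have "\<dots> = (\<Sum>(e, a)\<in>?EA. measure_pmf.expectation ?L
                      (\<lambda>st. reward G e a * indicator {st. (e, a) \<in> snd st} st))"
    by (intro sum.cong) auto
  also have "\<dots> = measure_pmf.expectation ?L
                    (\<lambda>st. \<Sum>(e, a)\<in>?EA. reward G e a * indicator {st. (e, a) \<in> snd st} st)"
    unfolding case_prod_unfold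
    by (intro Bochner_Integration.integral_sum[symmetric] integrable_mult_right
          measure_pmf.integrable_const_bound[where B = 1]) (auto simp: indicator_def)
  also have "\<dots> = measure_pmf.expectation ?L (\<lambda>st. matching_reward G (snd st))"
  proof (intro integral_cong_AE AE_pmfI)
    fix st assume "st \<in> set_pmf ?L"
    then have "snd st \<subseteq> ?EA" using L by blast
    \<comment> \<open>Every matched pair lies in \<open>?EA\<close>, so the indicators select
      exactly the matching.\<close>
    then have "(\<Sum>x\<in>?EA. if x \<in> snd st then reward G (fst x) (snd x) else 0) =
               (\<Sum>x\<in>snd st. reward G (fst x) (snd x))"
      using fin by (simp add: sum.If_cases Int_absorb1)
    then show "(\<Sum>(e, a)\<in>?EA. reward G e a * indicator {st. (e, a) \<in> snd st} st) =
               matching_reward G (snd st)"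
      by (simp add: matching_reward_def case_prod_unfold indicator_def of_bool_def if_distrib cong: if_cong)
  qed auto
  also have "\<dots> = expected_reward G (rounding_policy G z \<psi>)"
    by (simp add: expected_reward_def rounding_policy_eq_lazy[OF assms(2,3)])
  finally show ?thesis .
qed

end
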